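(* Let $a<b$ be real numbers, $\Delta=\{(t,\tau)\in\mathbb{R}^2: a\le\tau<t\le b\}$ and $\alpha:\Delta\to\mathbb{R}$. Suppose there is $n\in\mathbb{N}$ with $n\ge 2$ such that $0<\alpha(t,\tau)<1-\frac1n$ for all $(t,\tau)\in\Delta$. (i) If $f\in C^1([a,b];\mathbb{R})$, $g\in C([a,b];\mathbb{R})$ and ${}_{t}I^{1-\alpha(\cdot,\cdot)}_{b}g\in AC[a,b]$, then $$\int_a^b g(t)\;{}^{C}_{a}D^{\alpha(\cdot,\cdot)}_{t}f(t)\,dt=\left.f(t)\;{}_{t}I^{1-\alpha(\cdot,\cdot)}_{b}g(t)\right|_a^b+\int_a^b f(t)\;{}_{t}D^{\alpha(\cdot,\cdot)}_{b}g(t)\,dt .$$ (ii) If $f\in C^1([a,b];\mathbb{R})$, $g\in C([a,b];\mathbb{R})$ and ${}_{a}I^{1-\alpha(\cdot,\cdot)}_{t}g\in AC[a,b]$, then $$\int_a^b g(t)\;{}^{C}_{t}D^{\alpha(\cdot,\cdot)}_{b}f(t)\,dt=-\left.f(t)\;{}_{a}I^{1-\alpha(\cdot,\cdot)}_{t}g(t)\right|_a^b+\int_a^b f(t)\;{}_{a}D^{\alpha(\cdot,\cdot)}_{t}g(t)\,dt .$$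
   Context: $AC[a,b]$ is the space of absolutely continuous functions on $[a,b]$ and $\Gamma$ is the Gamma function. For $\alpha:\Delta\to(0,1)$ the following operators are used. Riemann--Liouville integrals of variable order $1-\alpha(\cdot,\cdot)$: $${}_{a}I^{1-\alpha(\cdot,\cdot)}_{t}g(t)=\int_a^t\frac{(t-\tau)^{-\alpha(t,\tau)}}{\Gamma(1-\alpha(t,\tau))}g(\tau)\,d\tau\ (t>a),\qquad {}_{t}I^{1-\alpha(\cdot,\cdot)}_{b}g(t)=\int_t^b\frac{(\tau-t)^{-\alpha(\tau,t)}}{\Gamma(1-\alpha(\tau,t))}g(\tau)\,d\tau\ (t<b),$$ where at $t=a$, respectively $t=b$, the integral over the degenerate interval is $0$. Riemann--Liouville derivatives (defined when the corresponding integral of order $1-\alpha(\cdot,\cdot)$ is in $AC[a,b]$): $${}_{a}D^{\alpha(\cdot,\cdot)}_{t}g(t)=\frac{d}{dt}\,{}_{a}I^{1-\alpha(\cdot,\cdot)}_{t}g(t)\ (t>a),\qquad {}_{t}D^{\alpha(\cdot,\cdot)}_{b}g(t)=-\frac{d}{dt}\,{}_{t}I^{1-\alpha(\cdot,\cdot)}_{b}g(t)\ (t<b).$$ Caputo derivatives (for $f\in AC[a,b]$): $${}^{C}_{a}D^{\alpha(\cdot,\cdot)}_{t}f(t)=\int_a^t\frac{(t-\tau)^{-\alpha(t,\tau)}}{\Gamma(1-\alpha(t,\tau))}f'(\tau)\,d\tau\ (t>a),\qquad {}^{C}_{t}D^{\alpha(\cdot,\cdot)}_{b}f(t)=\int_t^b\frac{-(\tau-t)^{-\alpha(\tau,t)}}{\Gamma(1-\alpha(\tau,t))}f'(\tau)\,d\tau\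 (t<b).$$ As is implicit in these formulas, the order function is understood to be (Lebesgue) measurable, so that the integrals make sense as Lebesgue integrals. *)

theory Defs
  imports "HOL-Analysis.Analysis"
begin

definition order_domain :: "real \<Rightarrow> real \<Rightarrow> (real \<times> real) set" where
  "order_domain a b = {(t, \<tau>). a \<le> \<tau> \<and> \<tau> < t \<and> t \<le> b}"

text \<open>Absolute continuity of a function on a real interval (the library constant
  \<^const>\<open>absolutely_continuous\<close> is the unrelated notion for measures). A finite family of
  non-overlapping closed subintervals is given by its set of pairs of endpoints.\<close>

definition absolutely_continuous_on :: "real set \<Rightarrow> (real \<Rightarrow> real) \<Rightarrow> bool" where
  "absolutely_continuous_on S F \<longleftrightarrow>
    (\<forall>\<epsilon>>0. \<exists>\<delta>>0. \<forall>D :: (real \<times> real) set.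
      finite D \<and> (\<forall>(u, v)\<in>D. u \<le> v \<and> {u..v} \<subseteq> S) \<and>
      disjoint_family_on (\<lambda>(u, v). {u<..<v}) D \<and>
      (\<Sum>(u, v)\<in>D. v - u) < \<delta> \<longrightarrow>
      (\<Sum>(u, v)\<in>D. \<bar>F v - F u\<bar>) < \<epsilon>)"

text \<open>One-sided derivatives at the endpoints, in contrast to \<^const>\<open>C1_differentiable_on\<close>,
  which would depend on the values of the function outside the interval.\<close>

definition C1_on_interval :: "real \<Rightarrow> real \<Rightarrow> (real \<Rightarrow> real) \<Rightarrow> bool" where
  "C1_on_interval a b f \<longleftrightarrow>
    (\<exists>f'. (\<forall>x\<in>{a..b}. (f has_real_derivative f' x) (at x within {a..b})) \<and>
          continuous_on {a..b} f')"

text \<open>The operators below take \<open>\<alpha>\<close> as argument; the fractional integrals are those of order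
  \<open>1 - \<alpha>(\<cdot>,\<cdot>)\<close>, the derivatives those of order \<open>\<alpha>(\<cdot>,\<cdot>)\<close>. The half-open domains of integration
  ensure that only values of \<open>\<alpha>\<close> on \<^const>\<open>order_domain\<close> are used, and make the integrals over
  degenerate intervals \<open>0\<close>. Note the exchanged arguments of the kernel in the right operators.\<close>

definition vo_kernel :: "(real \<times> real \<Rightarrow> real) \<Rightarrow> real \<Rightarrow> real \<Rightarrow> real" where
  "vo_kernel \<alpha> t \<tau> = (t - \<tau>) powr (- \<alpha> (t, \<tau>)) / Gamma (1 - \<alpha> (t, \<tau>))"

definition left_RL_integral ::
    "real \<Rightarrow> (real \<times> real \<Rightarrow> real) \<Rightarrow> (real \<Rightarrow> real) \<Rightarrow> real \<Rightarrow> real" where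
  "left_RL_integral a \<alpha> g t = (LINT \<tau>:{a..<t}|lebesgue. vo_kernel \<alpha> t \<tau> * g \<tau>)"

definition right_RL_integral ::
    "real \<Rightarrow> (real \<times> real \<Rightarrow> real) \<Rightarrow> (real \<Rightarrow> real) \<Rightarrow> real \<Rightarrow> real" where
  "right_RL_integral b \<alpha> g t = (LINT \<tau>:{t<..b}|lebesgue. vo_kernel \<alpha> \<tau> t * g \<tau>)"

text \<open>Differentiation takes place within \<open>[a,b]\<close>, the interval on which the functions live;
  hence the extra argument.\<close>

definition left_RL_deriv ::
    "real \<Rightarrow> real \<Rightarrow> (real \<times> real \<Rightarrow> real) \<Rightarrow> (real \<Rightarrow> real) \<Rightarrow> real \<Rightarrow> real" where
  "left_RL_deriv a b \<alpha> g t =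
    vector_derivative (left_RL_integral a \<alpha> g) (at t within {a..b})"

definition right_RL_deriv ::
    "real \<Rightarrow> real \<Rightarrow> (real \<times> real \<Rightarrow> real) \<Rightarrow> (real \<Rightarrow> real) \<Rightarrow> real \<Rightarrow> real" where
  "right_RL_deriv a b \<alpha> g t =
    - vector_derivative (right_RL_integral b \<alpha> g) (at t within {a..b})"

definition left_Caputo_deriv ::
    "real \<Rightarrow> real \<Rightarrow> (real \<times> real \<Rightarrow> real) \<Rightarrow> (real \<Rightarrow> real) \<Rightarrow> real \<Rightarrow> real" where
  "left_Caputo_deriv a b \<alpha> f t =
    (LINT \<tau>:{a..<t}|lebesgue. vo_kernel \<alpha> t \<tau> * vector_derivative f (at \<tau> within {a..b}))"

definition right_Caputo_deriv ::
    "real \<Rightarrow> real \<Rightarrow> (real \<times> real \<Rightarrow> real) \<Rightarrow> (real \<Rightarrow> real) \<Rightarrow> real \<Rightarrow> real" where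
  "right_Caputo_deriv a b \<alpha> f t =
    (LINT \<tau>:{t<..b}|lebesgue. - vo_kernel \<alpha> \<tau> t * vector_derivative f (at \<tau> within {a..b}))"

end

theory Submission
  imports Defs
begin

text \<open>Both identities are an exchange of the order of integration followed by an integration by
  parts.

  The left Caputo derivative of \<open>f\<close> is the left fractional integral of \<open>f'\<close>, and the left and the
  right fractional integral have the same kernel \<open>k(t,\<tau>)\<close>, integrated in \<open>\<tau>\<close> over \<open>[a,t)\<close> and in
  \<open>t\<close> over \<open>(\<tau>,b]\<close>. Fubini's theorem on the triangle of all \<open>a \<le> \<tau> < t \<le> b\<close> therefore moves the
  integral from \<open>f'\<close> to \<open>g\<close>: the integral of \<open>g\<close> times the left integral of \<open>f'\<close> is the integral of
  \<open>f'\<close> times the right integral of \<open>g\<close>; this is \<open>variable_order_integrals_exchange\<close>. It applies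
  because the order stays below \<open>1 - 1/n\<close>, so that the kernel is dominated by a constant multiple of
  the integrable function \<open>1 + (t - \<tau>) powr (- (1 - 1/n))\<close>; here \<open>1 / \<Gamma>\<close> is harmless, being
  continuous. For the right Caputo derivative the same identity is read in the other direction.

  What remains is to integrate \<open>f' F\<close> by parts, where \<open>F\<close> is a fractional integral of \<open>g\<close>. By
  assumption \<open>F\<close> is absolutely continuous, and so is \<open>f F\<close>. The formula is thus the fundamental
  theorem of calculus for absolutely continuous functions: such a function is differentiable almost
  everywhere, its derivative is Lebesgue integrable, and the integral of the derivative is the
  increment. It is proved as follows.

  \<^item> Differentiability almost everywhere rests on Vitali coverings. Fix \<open>l < h\<close> and let \<open>E\<close> be the
    set of points that lie in arbitrarily short intervals of slope below \<open>l\<close> and also in arbitrarily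
    short intervals of slope above \<open>h\<close>. Cover \<open>E\<close> by disjoint intervals of slope below \<open>l\<close> inside an
    open set hardly larger than \<open>E\<close>, and then by disjoint intervals of slope above \<open>h\<close> inside the
    first ones. Both families have a total length close to the outer measure of \<open>E\<close>, so they differ by
    a set of small measure, over which \<open>F\<close> varies little by absolute continuity. Hence \<open>h\<close> times the
    outer measure is at most \<open>l\<close> times the outer measure, up to a small error, and \<open>E\<close> is negligible.
  \<^item> The integral of the derivative is found as a gauge integral. At points of differentiability the
    gauge makes the Riemann summands close to the increments of \<open>F\<close>. At the points of the exceptional
    null set it forces the intervals into an open set of small measure, where absolute continuity
    bounds the sum of the increments.
  \<^item> The gauge integral is a Lebesgue integral because \<open>F\<close> has bounded variation on short intervals.\<close>

section \<open>Absolute continuity in terms of divisions of intervals\<close>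

abbreviation increment :: "(real \<Rightarrow> real) \<Rightarrow> real set \<Rightarrow> real" where
  "increment F K \<equiv> F (Sup K) - F (Inf K)"

lemma division_element_real:
  fixes S :: "real set"
  assumes "p division_of S" "K \<in> p"
  obtains u v where "K = {u..v}" "u \<le> v" "Inf K = u" "Sup K = v" "measure lebesgue K = v - u" "K \<subseteq> S"
proof -
  obtain u v where K: "K = cbox u v"
    using division_ofD(4)[OF assms] by blast
  then have uv: "u \<le> v"
    using division_ofD(3)[OF assms] by auto
  then show thesis
    using K division_ofD(2)[OF assms] by (intro that[of u v]) auto
qed

text \<open>Covering theorems and gauge integrals produce sets of intervals that overlap at most in end
  points. This is how absolute continuity is applied to them.\<close>

lemma absolutely_continuous_on_division:
  assumes "absolutely_continuous_on S F" "\<epsilon> > 0"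
  obtains \<delta> where "\<delta> > 0"
    "\<And>p T. \<lbrakk>p division_of T; T \<subseteq> S; (\<Sum>K\<in>p. measure lebesgue K) < \<delta>\<rbrakk> \<Longrightarrow> (\<Sum>K\<in>p. \<bar>increment F K\<bar>) < \<epsilon>"
proof -
  from assms(1)[unfolded absolutely_continuous_on_def, THEN spec, THEN mp, OF assms(2)]
  obtain \<delta> where "\<delta> > 0" and \<delta>: "\<forall>D :: (real \<times> real) set.
      finite D \<and> (\<forall>(u, v)\<in>D. u \<le> v \<and> {u..v} \<subseteq> S) \<and>
      disjoint_family_on (\<lambda>(u, v). {u<..<v}) D \<and>
      (\<Sum>(u, v)\<in>D. v - u) < \<delta> \<longrightarrow> (\<Sum>(u, v)\<in>D. \<bar>F v - F u\<bar>) < \<epsilon>"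
    by (elim exE conjE) (rule that)
  show thesis
  proof (rule that[OF \<open>\<delta> > 0\<close>])
    fix p T
    assume p: "p division_of T" and "T \<subseteq> S" and sm: "(\<Sum>K\<in>p. measure lebesgue K) < \<delta>"
    let ?e = "\<lambda>K::real set. (Inf K, Sup K)"
    have inj: "inj_on ?e p"
    proof (rule inj_onI)
      fix K L assume KL: "K \<in> p" "L \<in> p" and eq: "?e K = ?e L"
      have hull: "{Inf M..Sup M} = M" if "M \<in> p" for M
        by (rule division_element_real[OF p that]) simp
      have "{Inf K..Sup K} = {Inf L..Sup L}"
        using eq by simp
      then show "K = L"
        unfolding hull[OF KL(1)] hull[OF KL(2)] .
    qed
    have "(\<Sum>(u, v)\<in>?e ` p. \<bar>F v - F u\<bar>) < \<epsilon>"
    proof (rule \<delta>[THEN spec, THEN mp], intro conjI)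
      show "finite (?e ` p)"
        using division_ofD(1)[OF p] by (rule finite_imageI)
      show "\<forall>(u, v)\<in>?e ` p. u \<le> v \<and> {u..v} \<subseteq> S"
      proof clarify
        fix K assume "K \<in> p"
        then show "Inf K \<le> Sup K \<and> {Inf K..Sup K} \<subseteq> S"
          by (rule division_element_real[OF p]) (use \<open>T \<subseteq> S\<close> in auto)
      qed
      show "disjoint_family_on (\<lambda>(u, v). {u<..<v}) (?e ` p)"
        unfolding disjoint_family_on_def
      proof (intro ballI impI)
        fix m n assume "m \<in> ?e ` p" "n \<in> ?e ` p" "m \<noteq> n"
        then obtain K L where KL: "K \<in> p" "L \<in> p" "m = ?e K" "n = ?e L" "K \<noteq> L"
          by auto
        then have "interior K \<inter> interior L = {}"
          using division_ofD(5)[OF p] by blast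
        moreover have "interior M = {Inf M<..<Sup M}" if "M \<in> p" for M
          by (rule division_element_real[OF p that]) simp
        ultimately show "(case m of (u, v) \<Rightarrow> {u<..<v}) \<inter> (case n of (u, v) \<Rightarrow> {u<..<v}) = {}"
          using KL by simp
      qed
      have "(\<Sum>(u, v)\<in>?e ` p. v - u) = (\<Sum>K\<in>p. Sup K - Inf K)"
        by (simp add: sum.reindex[OF inj] o_def)
      also have "\<dots> = (\<Sum>K\<in>p. measure lebesgue K)"
        by (rule sum.cong) (auto elim!: division_element_real[OF p])
      finally show "(\<Sum>(u, v)\<in>?e ` p. v - u) < \<delta>"
        using sm by simp
    qed
    then show "(\<Sum>K\<in>p. \<bar>increment F K\<bar>) < \<epsilon>"
      by (simp add: sum.reindex[OF inj] o_def)
  qed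
qed

lemma sum_increment_division:
  assumes "a \<le> b" and p: "p division_of {a..b}"
  shows "(\<Sum>K\<in>p. increment F K) = F b - F a"
proof -
  let ?t = "\<lambda>K::real set. (Inf K, K)"
  have "?t ` p tagged_division_of {a..b}"
    unfolding tagged_division_of
  proof (intro conjI allI impI)
    show "finite (?t ` p)" using p by blast
    fix x K assume "(x, K) \<in> ?t ` p"
    then have K: "K \<in> p" "x = Inf K" by auto
    obtain u v where "K = {u..v}" "u \<le> v" "Inf K = u" "K \<subseteq> {a..b}"
      by (rule division_element_real[OF p K(1)]) blast
    with K(2) show "x \<in> K" "K \<subseteq> {a..b}" "\<exists>a b. K = cbox a b"
      by auto
  next
    fix x K y L assume "(x, K) \<in> ?t ` p \<and> (y, L) \<in> ?t ` p \<and> (x, K) \<noteq> (y, L)"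
    then show "interior K \<inter> interior L = {}"
      using division_ofD(5)[OF p] by auto
  next
    have "{K. \<exists>x. (x, K) \<in> ?t ` p} = p" by auto
    then show "\<Union>{K. \<exists>x. (x, K) \<in> ?t ` p} = {a..b}"
      using division_ofD(6)[OF p] by simp
  qed
  from additive_tagged_division_1[OF \<open>a \<le> b\<close> this, of F]
  show ?thesis
    by (simp add: sum.reindex inj_on_def o_def)
qed

text \<open>An arbitrary set \<open>S\<close> is not an interval, so increments over its divisions cannot be telescoped
  directly. But a common completion of both divisions to a division of \<open>[a,b]\<close> has the telescoping
  sum \<open>F b - F a\<close> in either case.\<close>

lemma sum_increment_division_eq:
  assumes p: "p division_of S" and r: "r division_of S" and S: "S \<subseteq> {a..b}"
  shows "(\<Sum>K\<in>p. increment F K) = (\<Sum>K\<in>r. increment F K)"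
proof (cases "a \<le> b")
  case False
  then have "S = {}" using S by auto
  then show ?thesis using p r by (simp add: division_of_trivial)
next
  case True
  obtain q where q: "p \<subseteq> q" "q division_of {a..b}"
    using partial_division_extend_interval[of p a b] p S division_ofD(6)[OF p]
    by (metis box_real(2))
  let ?g = "q - p"
  have g: "?g division_of \<Union>?g"
    using division_of_subset[of q ?g] q(2) division_ofD(6)[OF q(2)] by blast
  have disj: "interior S \<inter> interior (\<Union>?g) = {}"
  proof (rule Int_interior_Union_intervals)
    show "finite ?g" "\<And>T. T \<in> ?g \<Longrightarrow> \<exists>a b. T = cbox a b"
      using division_ofD(1)[OF g] division_ofD(4)[OF g] by blast+
    fix T assume T: "T \<in> ?g"
    have "interior T \<inter> interior (\<Union>p) = {}"
    proof (rule Int_interior_Union_intervals)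
      show "\<And>K. K \<in> p \<Longrightarrow> interior T \<inter> interior K = {}"
        using T q division_ofD(5)[OF q(2)] by blast
    qed (use division_ofD(1,4)[OF p] in auto)
    then show "interior S \<inter> interior T = {}"
      using division_ofD(6)[OF p] by auto
  qed auto
  have Sg: "S \<union> \<Union>?g = {a..b}"
    using division_ofD(6)[OF p] division_ofD(6)[OF q(2)] q(1) by blast
  have split: "(\<Sum>K\<in>s. increment F K) + (\<Sum>K\<in>?g. increment F K) = F b - F a"
    if s: "s division_of S" for s
  proof -
    have d: "(s \<union> ?g) division_of {a..b}"
      using division_disjoint_union[OF s g disj] Sg by simp
    (* a common member of s and ?g is a single point, as the interiors are disjoint *)
    have "increment F K = 0" if "K \<in> s \<inter> ?g" for K
    proof -
      have "interior K \<subseteq> interior S \<inter> interior (\<Union>?g)"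
        using that division_ofD(2)[OF s] by (intro Int_greatest interior_mono) auto
      then have "interior K = {}" using disj by blast
      then show ?thesis
        by (rule_tac division_element_real[OF s, of K]) (use that in auto)
    qed
    then have "(\<Sum>K\<in>s \<union> ?g. increment F K) = (\<Sum>K\<in>s. increment F K) + (\<Sum>K\<in>?g. increment F K)"
      using s g by (subst sum.union_inter_neutral) auto
    then show ?thesis
      using sum_increment_division[OF True d] by simp
  qed
  from split[OF p] split[OF r] show ?thesis by simp
qed

text \<open>The intervals of \<open>r\<close> can be completed to a division of \<open>S\<close>, whose additional intervals have
  total length below \<open>\<delta>\<close>. This lemma is what replaces monotonicity in the classical proof that
  monotone functions are differentiable almost everywhere.\<close>

lemma increment_division_close:
  assumes AC: "absolutely_continuous_on {a..b} F" and "\<epsilon> > 0"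
  obtains \<delta> where "\<delta> > 0"
    "\<And>p r S T. \<lbrakk>p division_of S; r division_of T; T \<subseteq> S; S \<subseteq> {a..b};
        measure lebesgue S - measure lebesgue T < \<delta>\<rbrakk>
      \<Longrightarrow> \<bar>(\<Sum>K\<in>p. increment F K) - (\<Sum>K\<in>r. increment F K)\<bar> < \<epsilon>"
proof -
  obtain \<delta> where "\<delta> > 0" and \<delta>: "\<And>p T. \<lbrakk>p division_of T; T \<subseteq> {a..b}; (\<Sum>K\<in>p. measure lebesgue K) < \<delta>\<rbrakk>
      \<Longrightarrow> (\<Sum>K\<in>p. \<bar>increment F K\<bar>) < \<epsilon>"
    using absolutely_continuous_on_division[OF assms] by blast
  show thesis
  proof (rule that[OF \<open>\<delta> > 0\<close>])
    fix p r S T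
    assume p: "p division_of S" and r: "r division_of T" and TS: "T \<subseteq> S" and S: "S \<subseteq> {a..b}"
      and close: "measure lebesgue S - measure lebesgue T < \<delta>"
    obtain q where q: "r \<subseteq> q" "q division_of S"
      using partial_division_extend[OF r p TS] .
    have fin: "finite q" "finite r"
      using division_ofD(1)[OF q(2)] division_ofD(1)[OF r] .
    have "(\<Sum>K\<in>q - r. measure lebesgue K) = measure lebesgue S - measure lebesgue T"
      using content_division[OF q(2)] content_division[OF r] sum_diff[OF fin(1) q(1), of "measure lebesgue"]
      by simp
    moreover have "q - r division_of \<Union>(q - r)"
      using division_of_subset[of q "q - r"] q(2) division_ofD(6)[OF q(2)] by blast
    moreover have "\<Union>(q - r) \<subseteq> {a..b}"
      using division_ofD(6)[OF q(2)] S by blast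
    ultimately have "(\<Sum>K\<in>q - r. \<bar>increment F K\<bar>) < \<epsilon>"
      using close by (intro \<delta>) auto
    moreover have "(\<Sum>K\<in>p. increment F K) - (\<Sum>K\<in>r. increment F K) = (\<Sum>K\<in>q - r. increment F K)"
      using sum_increment_division_eq[OF p q(2) S, of F] sum_diff[OF fin(1) q(1), of "increment F"]
      by simp
    ultimately show "\<bar>(\<Sum>K\<in>p. increment F K) - (\<Sum>K\<in>r. increment F K)\<bar> < \<epsilon>"
      by (metis order.strict_trans1 sum_abs)
  qed
qed

section \<open>Almost everywhere differentiability\<close>

text \<open>The Vitali covering theorem gives countably many disjoint intervals. All but finitely many of
  them have small total measure; these, the null set missed by the covering and the finitely many end
  points together form \<open>T\<close>. Discarding the end points puts the rest of \<open>E\<close> into the \<^emph>\<open>interior\<close> of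
  the finite union, so that a second covering can be started inside it.\<close>

lemma finite_Vitali_intervals:
  fixes E :: "real set"
  assumes ivl: "\<And>K. K \<in> \<F> \<Longrightarrow> \<exists>u v. u < v \<and> K = {u..v} \<and> K \<subseteq> {a..b}"
    and fine: "\<And>x d. x \<in> E \<Longrightarrow> 0 < d \<Longrightarrow> \<exists>K\<in>\<F>. x \<in> K \<and> measure lebesgue K < d"
    and "\<eta> > 0"
  obtains p T where "p division_of \<Union>p" "p \<subseteq> \<F>" "T \<in> lmeasurable" "measure lebesgue T < \<eta>"
    "E \<subseteq> T \<union> interior (\<Union>p)"
proof -
  define c r where "c = (\<lambda>K::real set. (Inf K + Sup K) / 2)" and "r = (\<lambda>K::real set. (Sup K - Inf K) / 2)"
  have cb: "cball (c K) (r K) = K" and r: "0 < r K" "r K = measure lebesgue K / 2" if K: "K \<in> \<F>" for K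
  proof -
    obtain u v where "u < v" "K = {u..v}" using ivl[OF K] by blast
    then show "cball (c K) (r K) = K" "0 < r K" "r K = measure lebesgue K / 2"
      by (auto simp: c_def r_def cball_eq_atLeastAtMost field_simps)
  qed
  have cover: "\<exists>K. K \<in> \<F> \<and> x \<in> cball (c K) (r K) \<and> r K < d" if "x \<in> E" "0 < d" for x d
    using fine[of x "2 * d"] that cb r(2) by fastforce
  obtain C where C: "countable C" "C \<subseteq> \<F>"
    "pairwise (\<lambda>i j. disjnt (cball (c i) (r i)) (cball (c j) (r j))) C"
    "negligible (E - (\<Union>i\<in>C. cball (c i) (r i)))"
    using Vitali_covering_theorem_cballs[of \<F> r E c, OF r(1) cover] by blast
  have "(\<Union>i\<in>C. cball (c i) (r i)) = \<Union>C"
    using cb C(2) by force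
  then have neg: "negligible (E - \<Union>C)"
    using C(4) by simp
  have disj: "K \<inter> L = {}" if "K \<in> C" "L \<in> C" "K \<noteq> L" for K L
    using C(2,3) cb that unfolding pairwise_def disjnt_def by (metis subsetD)
  have Csub: "\<Union>C \<subseteq> {a..b}"
    using C(2) ivl by blast
  have Cm: "K \<in> lmeasurable" if "K \<in> C" for K
    using ivl[of K] C(2) that by auto
  have UCm: "\<Union>D \<in> lmeasurable" if "D \<subseteq> C" for D
  proof (rule bounded_set_imp_lmeasurable)
    show "bounded (\<Union>D)"
      by (rule bounded_subset[OF bounded_closed_interval]) (use Csub that in blast)
    show "\<Union>D \<in> sets lebesgue"
      by (rule sets.countable_Union[OF countable_subset[OF that C(1)]]) (use Cm that in auto)
  qed
  obtain p where p: "p \<subseteq> C" "finite p" "measure lebesgue (\<Union>C) - \<eta> < measure lebesgue (\<Union>p)"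
  proof (rule measure_countable_Union_approachable[OF C(1) \<open>\<eta> > 0\<close> Cm, where B = "measure lebesgue {a..b}"])
    fix D assume "D \<subseteq> C" "finite D"
    then show "measure lebesgue (\<Union>D) \<le> measure lebesgue {a..b}"
      using Csub UCm[of D] by (intro measure_mono_fmeasurable) auto
  qed (assumption, rule that)
  define R where "R = (\<Union>C - \<Union>p) \<union> ((E - \<Union>C) \<union> (\<Union>K\<in>p. {Inf K, Sup K}))"
  show thesis
  proof (rule that)
    show "p division_of \<Union>p"
    proof (rule division_ofI[OF p(2)])
      fix K assume K: "K \<in> p"
      show "K \<subseteq> \<Union>p" using K by blast
      obtain u v where uv: "u < v" "K = {u..v}" using ivl[of K] K p(1) C(2) by blast
      show "K \<noteq> {}" using uv by simp
      show "\<exists>a b. K = cbox a b" using uv by (metis box_real(2))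
      fix L assume "L \<in> p" "K \<noteq> L"
      then show "interior K \<inter> interior L = {}"
        using disj[of K L] K p(1) interior_subset by blast
    qed simp
    show "p \<subseteq> \<F>" using p(1) C(2) by blast
    have small: "negligible ((E - \<Union>C) \<union> (\<Union>K\<in>p. {Inf K, Sup K}))"
      using neg p(2) by (intro negligible_Un) (auto intro: negligible_finite)
    have diff: "\<Union>C - \<Union>p \<in> lmeasurable"
      using UCm[OF subset_refl] UCm[OF p(1)] by (rule fmeasurable.Diff)
    show "R \<in> lmeasurable"
      unfolding R_def using diff negligible_imp_measurable[OF small] by (rule fmeasurable.Un)
    have "measure lebesgue R \<le> measure lebesgue (\<Union>C - \<Union>p) + 0"
      unfolding R_def negligible_imp_measure0[OF small, symmetric]
      by (intro measure_Un_le fmeasurableD diff negligible_imp_measurable[OF small])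
    also have "\<dots> = measure lebesgue (\<Union>C) - measure lebesgue (\<Union>p)"
      using measurable_measure_Diff[of "\<Union>C" lebesgue "\<Union>p"] UCm[OF subset_refl] UCm[OF p(1)] p(1)
      by (simp add: Union_mono fmeasurableD)
    finally show "measure lebesgue R < \<eta>"
      using p(3) by simp
    show "E \<subseteq> R \<union> interior (\<Union>p)"
    proof
      fix x assume "x \<in> E"
      show "x \<in> R \<union> interior (\<Union>p)"
      proof (cases "x \<in> R")
        case False
        then obtain K where K: "K \<in> p" "x \<in> K" "x \<noteq> Inf K" "x \<noteq> Sup K"
          using \<open>x \<in> E\<close> unfolding R_def by blast
        obtain u v where uv: "u < v" "K = {u..v}" using ivl[of K] K p(1) C(2) by blast
        then have "x \<in> interior K"
          using K by simp
        then show ?thesis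
          using interior_mono[of K "\<Union>p"] K(1) by blast
      qed simp
    qed
  qed
qed

text \<open>Difference quotients are taken over intervals that contain the point, possibly at an end, since
  these are the intervals that a covering by closed intervals provides.\<close>

definition straddles :: "real \<Rightarrow> real \<Rightarrow> real \<Rightarrow> real \<Rightarrow> real \<Rightarrow> real \<Rightarrow> bool" where
  "straddles a b d x u v \<longleftrightarrow> a \<le> u \<and> u \<le> x \<and> x \<le> v \<and> v \<le> b \<and> u < v \<and> v - u < d"

text \<open>The set \<open>E\<close> may fail to be measurable, so the argument works with its outer measure
  \<open>s\<close>. Let \<open>m1\<close> be the total length of the intervals of slope below \<open>l\<close> and \<open>m2\<close> that of the intervals
  of slope above \<open>h\<close> chosen inside them. Up to a multiple of \<open>e\<close>, both lengths equal \<open>s\<close>, and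
  \<open>h m2 \<le> l m1\<close> because \<open>F\<close> has nearly the same total increment over both families.\<close>

lemma negligible_oscillating_slopes:
  fixes l h :: real
  assumes AC: "absolutely_continuous_on {a..b} F" and "l < h" and E: "E \<subseteq> {a<..<b}"
    and lo: "\<And>x d. x \<in> E \<Longrightarrow> d > 0 \<Longrightarrow> \<exists>u v. straddles a b d x u v \<and> F v - F u < l * (v - u)"
    and hi: "\<And>x d. x \<in> E \<Longrightarrow> d > 0 \<Longrightarrow> \<exists>u v. straddles a b d x u v \<and> F v - F u > h * (v - u)"
  shows "negligible E"
proof -
  let ?\<mu> = "measure lebesgue"
  define s where "s = Inf (?\<mu> ` {T. T \<in> lmeasurable \<and> E \<subseteq> T})"
  have bdd: "bdd_below (?\<mu> ` {T. T \<in> lmeasurable \<and> E \<subseteq> T})"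
    by (rule bdd_belowI[of _ 0]) auto
  have s_le: "s \<le> ?\<mu> T" if "T \<in> lmeasurable" "E \<subseteq> T" for T
    unfolding s_def using that by (intro cInf_lower bdd) auto
  have s_approx: "\<exists>T. T \<in> lmeasurable \<and> E \<subseteq> T \<and> ?\<mu> T < s + e" if "e > 0" for e
  proof -
    have "{a..b} \<in> {T. T \<in> lmeasurable \<and> E \<subseteq> T}"
      using E by auto
    then have ne: "?\<mu> ` {T. T \<in> lmeasurable \<and> E \<subseteq> T} \<noteq> {}"
      by blast
    have "s < s + e" using that by simp
    then obtain m where "m \<in> ?\<mu> ` {T. T \<in> lmeasurable \<and> E \<subseteq> T}" "m < s + e"
      using cInf_lessD[OF ne] s_def by blast
    then show ?thesis by blast
  qed
  have main: "(h - l) * s < (3 * \<bar>l\<bar> + 1 + 2 * (h - l)) * e" if e: "e > 0" for e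
  proof -
    obtain \<delta> where "\<delta> > 0" and \<delta>: "\<And>p r S T. \<lbrakk>p division_of S; r division_of T; T \<subseteq> S; S \<subseteq> {a..b};
        ?\<mu> S - ?\<mu> T < \<delta>\<rbrakk> \<Longrightarrow> \<bar>(\<Sum>K\<in>p. increment F K) - (\<Sum>K\<in>r. increment F K)\<bar> < e"
      using increment_division_close[OF AC e] by blast
    (* m1 and m2 below differ by less than 3 * \<epsilon>, which has to stay below \<delta> *)
    define \<epsilon> where "\<epsilon> = min e (\<delta> / 4)"
    have \<epsilon>: "\<epsilon> > 0" "\<epsilon> \<le> e" "3 * \<epsilon> < \<delta>"
      using e \<open>\<delta> > 0\<close> unfolding \<epsilon>_def by auto
    obtain T0 where T0: "T0 \<in> lmeasurable" "E \<subseteq> T0" "?\<mu> T0 < s + \<epsilon> / 2"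
      using s_approx[of "\<epsilon> / 2"] \<epsilon>(1) by auto
    obtain G where G: "open G" "T0 \<subseteq> G" "G - T0 \<in> lmeasurable" "emeasure lebesgue (G - T0) < ennreal (\<epsilon> / 2)"
      using sets_lebesgue_outer_open[of T0 "\<epsilon> / 2"] T0(1) \<epsilon>(1) by auto
    define U where "U = G \<inter> {a<..<b}"
    have U: "open U" "E \<subseteq> U" "U \<subseteq> {a..b}"
      using G(1,2) T0(2) E unfolding U_def by auto
    have Um: "U \<in> lmeasurable"
      unfolding U_def using G(1) by (intro bounded_set_imp_lmeasurable) auto
    have "?\<mu> (G - T0) < \<epsilon> / 2"
      using G(3,4) \<epsilon>(1) by (simp add: emeasure_eq_measure2 ennreal_less_iff)
    moreover have "?\<mu> U \<le> ?\<mu> (T0 \<union> (G - T0))"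
      using T0(1) G(3) Um by (intro measure_mono_fmeasurable fmeasurable.Un) (auto simp: U_def)
    moreover have "?\<mu> (T0 \<union> (G - T0)) \<le> ?\<mu> T0 + ?\<mu> (G - T0)"
      using T0(1) G(3) by (intro measure_Un_le) auto
    ultimately have mU: "?\<mu> U < s + \<epsilon>"
      using T0(3) by linarith
    have refine: "\<exists>K\<in>{K. \<exists>u v. u < v \<and> K = {u..v} \<and> K \<subseteq> W \<and> P u v}. x \<in> K \<and> ?\<mu> K < d"
      if "open W" "x \<in> W" "d > 0" and P: "\<And>d. d > 0 \<Longrightarrow> \<exists>u v. straddles a b d x u v \<and> P u v"
      for W x d and P :: "real \<Rightarrow> real \<Rightarrow> bool"
    proof -
      obtain r where "r > 0" and r: "cball x r \<subseteq> W"
        using \<open>open W\<close> \<open>x \<in> W\<close> open_contains_cball by blast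
      obtain u v where uv: "straddles a b (min d r) x u v" "P u v"
        using P[of "min d r"] \<open>d > 0\<close> \<open>r > 0\<close> by auto
      have "{u..v} \<subseteq> cball x r"
        using uv(1) by (auto simp: straddles_def dist_real_def)
      then show ?thesis
        using r uv by (intro bexI[of _ "{u..v}"]) (auto simp: straddles_def)
    qed
    define \<F>1 where "\<F>1 = {K. \<exists>u v. u < v \<and> K = {u..v} \<and> K \<subseteq> U \<and> F v - F u < l * (v - u)}"
    obtain p1 T1 where p1: "p1 division_of \<Union>p1" "p1 \<subseteq> \<F>1" and T1: "T1 \<in> lmeasurable" "?\<mu> T1 < \<epsilon>"
      and E1: "E \<subseteq> T1 \<union> interior (\<Union>p1)"
    proof (rule finite_Vitali_intervals[of \<F>1 a b E \<epsilon>])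
      show "\<exists>u v. u < v \<and> K = {u..v} \<and> K \<subseteq> {a..b}" if "K \<in> \<F>1" for K
        using that U(3) unfolding \<F>1_def by blast
      show "\<exists>K\<in>\<F>1. x \<in> K \<and> ?\<mu> K < d" if "x \<in> E" "d > 0" for x d
        unfolding \<F>1_def using that U lo by (intro refine) auto
    qed (use \<epsilon> in auto)
    define V where "V = interior (\<Union>p1)"
    define \<F>2 where "\<F>2 = {K. \<exists>u v. u < v \<and> K = {u..v} \<and> K \<subseteq> V \<and> F v - F u > h * (v - u)}"
    have p1U: "\<Union>p1 \<subseteq> U"
      using p1(2) unfolding \<F>1_def by blast
    then have p1ab: "\<Union>p1 \<subseteq> {a..b}"
      using U(3) by blast
    have Vsub: "V \<subseteq> \<Union>p1"
      unfolding V_def by (rule interior_subset)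
    obtain p2 T2 where p2: "p2 division_of \<Union>p2" "p2 \<subseteq> \<F>2" and T2: "T2 \<in> lmeasurable" "?\<mu> T2 < \<epsilon>"
      and E2: "E \<inter> V \<subseteq> T2 \<union> interior (\<Union>p2)"
    proof (rule finite_Vitali_intervals[of \<F>2 a b "E \<inter> V" \<epsilon>])
      show "\<exists>u v. u < v \<and> K = {u..v} \<and> K \<subseteq> {a..b}" if "K \<in> \<F>2" for K
        using that p1ab Vsub unfolding \<F>2_def by blast
      show "\<exists>K\<in>\<F>2. x \<in> K \<and> ?\<mu> K < d" if "x \<in> E \<inter> V" "d > 0" for x d
        unfolding \<F>2_def using that hi by (intro refine) (auto simp: V_def)
    qed (use \<epsilon> in auto)
    have p21: "\<Union>p2 \<subseteq> \<Union>p1"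
      using p2(2) Vsub unfolding \<F>2_def by blast
    have pm: "\<Union>p1 \<in> lmeasurable" "\<Union>p2 \<in> lmeasurable"
      using lmeasurable_division[OF p1(1)] lmeasurable_division[OF p2(1)] .
    define m1 m2 where "m1 = ?\<mu> (\<Union>p1)" and "m2 = ?\<mu> (\<Union>p2)"
    have m1: "m1 < s + \<epsilon>"
      using measure_mono_fmeasurable[OF p1U, of lebesgue] pm(1) Um mU unfolding m1_def by auto
    have "s \<le> ?\<mu> (T1 \<union> (T2 \<union> \<Union>p2))"
      using T1(1) T2(1) pm(2) E1 E2 interior_subset[of "\<Union>p2"] unfolding V_def
      by (intro s_le fmeasurable.Un) blast+
    also have "\<dots> \<le> ?\<mu> T1 + ?\<mu> (T2 \<union> \<Union>p2)"
      using T1(1) T2(1) pm(2) by (intro measure_Un_le) auto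
    also have "?\<mu> (T2 \<union> \<Union>p2) \<le> ?\<mu> T2 + m2"
      unfolding m2_def using T2(1) pm(2) by (intro measure_Un_le) auto
    finally have m2: "s < m2 + 2 * \<epsilon>"
      using T1(2) T2(2) by simp
    have m21: "m2 \<le> m1"
      unfolding m1_def m2_def using pm p21 by (intro measure_mono_fmeasurable) auto
    have "\<bar>(\<Sum>K\<in>p1. increment F K) - (\<Sum>K\<in>p2. increment F K)\<bar> < e"
      using m1 m2 \<epsilon>(3) by (intro \<delta>[OF p1(1) p2(1) p21 p1ab]) (simp add: m1_def m2_def)
    moreover have "(\<Sum>K\<in>p1. increment F K) \<le> l * m1"
    proof -
      have "increment F K \<le> l * ?\<mu> K" if "K \<in> p1" for K
        using p1(2) that unfolding \<F>1_def by fastforce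
      then have "(\<Sum>K\<in>p1. increment F K) \<le> (\<Sum>K\<in>p1. l * ?\<mu> K)"
        by (rule sum_mono)
      then show ?thesis
        using content_division[OF p1(1)] by (simp add: m1_def sum_distrib_left[symmetric])
    qed
    moreover have "(\<Sum>K\<in>p2. increment F K) \<ge> h * m2"
    proof -
      have "increment F K \<ge> h * ?\<mu> K" if "K \<in> p2" for K
        using p2(2) that unfolding \<F>2_def by fastforce
      then have "(\<Sum>K\<in>p2. increment F K) \<ge> (\<Sum>K\<in>p2. h * ?\<mu> K)"
        by (rule sum_mono)
      then show ?thesis
        using content_division[OF p2(1)] by (simp add: m2_def sum_distrib_left[symmetric])
    qed
    ultimately have "h * m2 - e < l * m1"
      by linarith
    then have "(h - l) * m2 < l * (m1 - m2) + e"
      by (simp add: algebra_simps)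
    also have "l * (m1 - m2) \<le> \<bar>l\<bar> * (3 * e)"
    proof -
      have "l * (m1 - m2) \<le> \<bar>l\<bar> * (m1 - m2)"
        using m21 by (intro mult_right_mono) auto
      also have "\<dots> \<le> \<bar>l\<bar> * (3 * e)"
        using m1 m2 \<epsilon>(2) by (intro mult_left_mono) auto
      finally show ?thesis .
    qed
    finally have "(h - l) * m2 < (3 * \<bar>l\<bar> + 1) * e"
      by (simp add: algebra_simps)
    moreover have "(h - l) * s \<le> (h - l) * (m2 + 2 * e)"
      using m2 \<epsilon>(2) \<open>l < h\<close> by (intro mult_left_mono) auto
    ultimately show ?thesis
      by (simp add: algebra_simps)
  qed
  have "s \<le> 0"
  proof (rule ccontr)
    assume "\<not> s \<le> 0"
    (* for e = (h - l) * s / c the inequality main reads (h - l) * s < (h - l) * s *)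
    define c where "c = 3 * \<bar>l\<bar> + 1 + 2 * (h - l)"
    have "c > 0" using \<open>l < h\<close> by (simp add: c_def)
    then have "(h - l) * s < c * ((h - l) * s / c)"
      using main[of "(h - l) * s / c"] \<open>\<not> s \<le> 0\<close> \<open>l < h\<close> by (simp add: c_def)
    then show False using \<open>c > 0\<close> by simp
  qed
  then show ?thesis
    unfolding negligible_outer using s_approx by (meson add_increasing less_le_trans add_le_same_cancel2)
qed

text \<open>On an interval so short that the variation of \<open>F\<close> over it is below \<open>1\<close>, disjoint intervals of
  slope above \<open>M\<close> in absolute value have total length below \<open>1/M\<close>. So \<open>E\<close> is negligible locally, hence on \<open>[a,b]\<close>.\<close>

lemma negligible_unbounded_slopes:
  assumes "a < b" and AC: "absolutely_continuous_on {a..b} F" and E: "E \<subseteq> {a<..<b}"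
    and unb: "\<And>x M d. x \<in> E \<Longrightarrow> d > 0 \<Longrightarrow> \<exists>u v. straddles a b d x u v \<and> \<bar>F v - F u\<bar> > M * (v - u)"
  shows "negligible E"
proof -
  obtain \<delta> where "\<delta> > 0" and \<delta>: "\<And>p T. \<lbrakk>p division_of T; T \<subseteq> {a..b}; (\<Sum>K\<in>p. measure lebesgue K) < \<delta>\<rbrakk>
      \<Longrightarrow> (\<Sum>K\<in>p. \<bar>increment F K\<bar>) < 1"
    using absolutely_continuous_on_division[OF AC, of 1] by auto
  have small: "negligible (E \<inter> {c<..<d})" if "d - c < \<delta>" for c d
    unfolding negligible_outer
  proof (intro allI impI)
    fix \<eta> :: real assume "\<eta> > 0"
    define M where "M = 2 / \<eta>"
    define \<F> where "\<F> = {K. \<exists>u v. u < v \<and> K = {u..v} \<and> K \<subseteq> {a..b} \<inter> {c..d} \<and> \<bar>F v - F u\<bar> > M * (v - u)}"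
    obtain p T where p: "p division_of \<Union>p" "p \<subseteq> \<F>" and T: "T \<in> lmeasurable" "measure lebesgue T < \<eta> / 2"
      and sub: "E \<inter> {c<..<d} \<subseteq> T \<union> interior (\<Union>p)"
    proof (rule finite_Vitali_intervals[of \<F> a b "E \<inter> {c<..<d}" "\<eta> / 2"])
      show "\<exists>u v. u < v \<and> K = {u..v} \<and> K \<subseteq> {a..b}" if "K \<in> \<F>" for K
        using that unfolding \<F>_def by blast
      show "\<exists>K\<in>\<F>. x \<in> K \<and> measure lebesgue K < e" if "x \<in> E \<inter> {c<..<d}" "e > 0" for x e
      proof -
        obtain u v where "straddles a b (min e (min (x - c) (d - x))) x u v" "\<bar>F v - F u\<bar> > M * (v - u)"
          using unb[of x "min e (min (x - c) (d - x))" M] \<open>x \<in> E \<inter> {c<..<d}\<close> \<open>e > 0\<close> by auto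
        then show ?thesis
          unfolding \<F>_def by (intro bexI[of _ "{u..v}"]) (auto simp: straddles_def)
      qed
    qed (use \<open>\<eta> > 0\<close> in auto)
    have pm: "\<Union>p \<in> lmeasurable"
      by (rule lmeasurable_division[OF p(1)])
    have psub: "\<Union>p \<subseteq> {a..b}" "\<Union>p \<subseteq> {c..d}"
      using p(2) unfolding \<F>_def by blast+
    have "measure lebesgue (\<Union>p) \<le> measure lebesgue {c..d}"
      using psub(2) pm by (intro measure_mono_fmeasurable) auto
    then have "measure lebesgue (\<Union>p) < \<delta>"
      using that \<open>\<delta> > 0\<close> by (auto split: if_splits)
    then have "(\<Sum>K\<in>p. \<bar>increment F K\<bar>) < 1"
      using content_division[OF p(1)] by (intro \<delta>[OF p(1) psub(1)]) simp
    moreover have "(\<Sum>K\<in>p. M * measure lebesgue K) \<le> (\<Sum>K\<in>p. \<bar>increment F K\<bar>)"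
      using p(2) unfolding \<F>_def by (intro sum_mono) fastforce
    ultimately have "M * measure lebesgue (\<Union>p) < 1"
      using content_division[OF p(1)] by (simp add: sum_distrib_left[symmetric])
    then have "measure lebesgue (\<Union>p) < \<eta> / 2"
      using \<open>\<eta> > 0\<close> by (simp add: M_def field_simps)
    moreover have "measure lebesgue (T \<union> \<Union>p) \<le> measure lebesgue T + measure lebesgue (\<Union>p)"
      using T(1) pm by (intro measure_Un_le) auto
    ultimately have "measure lebesgue (T \<union> \<Union>p) < \<eta>"
      using T(2) by linarith
    moreover have "E \<inter> {c<..<d} \<subseteq> T \<union> \<Union>p"
      using sub interior_subset by blast
    ultimately show "\<exists>T. E \<inter> {c<..<d} \<subseteq> T \<and> T \<in> lmeasurable \<and> measure lebesgue T < \<eta>"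
      using T(1) pm by blast
  qed
  from \<open>a < b\<close> have "a \<le> b" by simp
  then have "negligible (E \<inter> {a..b})"
  proof (induction rule: Bolzano)
    case (trans c d e)
    have "E \<inter> {c..e} \<subseteq> (E \<inter> {c..d}) \<union> (E \<inter> {d..e})" by auto
    with trans show ?case by (meson negligible_Un negligible_subset)
  next
    case (local x)
    have "negligible (E \<inter> {c..d})" if "d - c < \<delta>" for c d
    proof (rule negligible_subset)
      show "negligible ((E \<inter> {c<..<d}) \<union> {c, d})"
        using small[OF that] by (intro negligible_Un) (auto intro: negligible_finite)
    qed auto
    then show ?case using \<open>\<delta> > 0\<close> by blast
  qed
  then show ?thesis
    by (rule negligible_subset) (use E in auto)
qed

text \<open>The derivative is the supremum of all \<open>y\<close> that bound the slopes over short intervals from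
  below. A rational number slightly above the supremum is not such a lower bound, and by hypothesis a
  slightly larger one is then an upper bound.\<close>

lemma derivative_from_slopes:
  assumes x: "a < x" "x < b"
    and bdd: "d0 > 0" "\<And>u v. straddles a b d0 x u v \<Longrightarrow> \<bar>F v - F u\<bar> \<le> M * (v - u)"
    and sep: "\<And>l h :: rat. l < h \<Longrightarrow> \<exists>d>0.
      (\<forall>u v. straddles a b d x u v \<longrightarrow> of_rat l * (v - u) \<le> F v - F u) \<or>
      (\<forall>u v. straddles a b d x u v \<longrightarrow> F v - F u \<le> of_rat h * (v - u))"
  shows "\<exists>L. (F has_real_derivative L) (at x)"
proof -
  have mono: "straddles a b d' x u v" if "straddles a b d x u v" "d \<le> d'" for d d' u v
    using that by (simp add: straddles_def)
  have ex: "\<exists>u v. straddles a b d x u v" if "d > 0" for d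
    using x that by (intro exI[of _ x] exI[of _ "min b (x + d / 2)"]) (auto simp: straddles_def min_def)
  define A where "A = {y. \<exists>d>0. \<forall>u v. straddles a b d x u v \<longrightarrow> y * (v - u) \<le> F v - F u}"
  have "- M \<in> A"
  proof -
    have "- M * (v - u) \<le> F v - F u" if "straddles a b d0 x u v" for u v
      using bdd(2)[OF that] by (simp add: abs_le_iff)
    then show ?thesis
      unfolding A_def using bdd(1) by blast
  qed
  have "y \<le> M" if yA: "y \<in> A" for y
  proof -
    obtain d where "d > 0" and d: "\<forall>u v. straddles a b d x u v \<longrightarrow> y * (v - u) \<le> F v - F u"
      using yA unfolding A_def by blast
    obtain u v where uv: "straddles a b (min d d0) x u v"
      using ex[of "min d d0"] \<open>d > 0\<close> bdd(1) by auto
    have "y * (v - u) \<le> M * (v - u)"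
      using d[rule_format, OF mono[OF uv]] bdd(2)[OF mono[OF uv]] by (simp add: abs_le_iff)
    then show ?thesis
      using uv by (simp add: straddles_def)
  qed
  then have bA: "bdd_above A"
    by (rule bdd_aboveI)
  define L where "L = Sup A"
  have key: "\<exists>d>0. \<forall>u v. straddles a b d x u v \<longrightarrow> \<bar>F v - F u - L * (v - u)\<bar> \<le> e * (v - u)" if "e > 0" for e
  proof -
    obtain y where "y \<in> A" "L - e < y"
      using less_cSupD[of A "L - e"] \<open>- M \<in> A\<close> \<open>e > 0\<close> unfolding L_def by auto
    then obtain d1 where "d1 > 0" and d1: "\<forall>u v. straddles a b d1 x u v \<longrightarrow> y * (v - u) \<le> F v - F u"
      unfolding A_def by blast
    obtain l :: rat where l: "L < of_rat l" "of_rat l < L + e"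
      using of_rat_dense[of L "L + e"] \<open>e > 0\<close> by auto
    obtain h :: rat where h: "real_of_rat l < of_rat h" "of_rat h < L + e"
      using of_rat_dense[of "of_rat l" "L + e"] l by auto
    have "of_rat l \<notin> A"
      using cSup_upper[OF _ bA, of "of_rat l"] l unfolding L_def by auto
    moreover have "l < h"
      using h(1) by (simp add: of_rat_less)
    ultimately obtain d2 where "d2 > 0" and
      d2: "\<And>u v. straddles a b d2 x u v \<Longrightarrow> F v - F u \<le> of_rat h * (v - u)"
      using sep[of l h] unfolding A_def by blast
    have "\<bar>F v - F u - L * (v - u)\<bar> \<le> e * (v - u)" if "straddles a b (min d1 d2) x u v" for u v
    proof -
      have "v - u > 0" using that by (simp add: straddles_def)
      then have "(L - e) * (v - u) \<le> y * (v - u)" "of_rat h * (v - u) \<le> (L + e) * (v - u)"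
        using \<open>L - e < y\<close> h(2) by (simp_all add: mult_right_mono)
      then show ?thesis
        using d1[rule_format, OF mono[OF that]] d2[OF mono[OF that]] by (simp add: abs_le_iff algebra_simps)
    qed
    then show ?thesis
      using \<open>d1 > 0\<close> \<open>d2 > 0\<close> by (intro exI[of _ "min d1 d2"]) auto
  qed
  have "(F has_derivative (*) L) (at x)"
    unfolding has_derivative_within_alt
  proof (intro conjI allI impI)
    fix e :: real assume "e > 0"
    then obtain d where "d > 0" and d: "\<And>u v. straddles a b d x u v \<Longrightarrow> \<bar>F v - F u - L * (v - u)\<bar> \<le> e * (v - u)"
      using key by blast
    have "\<bar>F y - F x - L * (y - x)\<bar> \<le> e * \<bar>y - x\<bar>" if "\<bar>y - x\<bar> < min d (min (x - a) (b - x))" for y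
    proof (cases y x rule: linorder_cases)
      case less
      then have "\<bar>F x - F y - L * (x - y)\<bar> \<le> e * (x - y)"
        using that by (intro d) (auto simp: straddles_def)
      moreover have "F y - F x - L * (y - x) = - (F x - F y - L * (x - y))"
        by (simp add: algebra_simps)
      ultimately show ?thesis
        using less by (metis abs_minus_cancel abs_minus_commute abs_of_pos diff_gt_0_iff_gt)
    next
      case greater
      then show ?thesis
        using that d[of x y] by (auto simp: straddles_def)
    qed simp
    then show "\<exists>d>0. \<forall>y\<in>UNIV. norm (y - x) < d \<longrightarrow> norm (F y - F x - L * (y - x)) \<le> e * norm (y - x)"
      using \<open>d > 0\<close> x by (intro exI[of _ "min d (min (x - a) (b - x))"]) auto
  qed (rule bounded_linear_mult_right)
  then show ?thesis
    by (auto simp: has_field_derivative_def)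
qed

text \<open>Rational \<open>l\<close> and \<open>h\<close> suffice to detect oscillation of the slopes, which leaves countably many
  negligible sets.\<close>

lemma absolutely_continuous_on_differentiable_ae:
  assumes "a < b" and AC: "absolutely_continuous_on {a..b} F"
  obtains N where "negligible N" "\<And>x. x \<in> {a..b} - N \<Longrightarrow> \<exists>L. (F has_real_derivative L) (at x)"
proof -
  define lows where "lows l x \<longleftrightarrow> (\<forall>d>0. \<exists>u v. straddles a b d x u v \<and> F v - F u < l * (v - u))" for l x
  define highs where "highs h x \<longleftrightarrow> (\<forall>d>0. \<exists>u v. straddles a b d x u v \<and> F v - F u > h * (v - u))" for h x
  define O1 where "O1 = (\<Union>(l, h)\<in>{(l, h). l < h}.
      {x \<in> {a<..<b}. lows (real_of_rat l) x \<and> highs (real_of_rat h) x})"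
  define O2 where "O2 = {x \<in> {a<..<b}. \<forall>M. \<forall>d>0. \<exists>u v. straddles a b d x u v \<and> \<bar>F v - F u\<bar> > M * (v - u)}"
  have "negligible {x \<in> {a<..<b}. lows (real_of_rat l) x \<and> highs (real_of_rat h) x}" if "l < h" for l h
    by (rule negligible_oscillating_slopes[OF AC, of "real_of_rat l" "real_of_rat h"])
      (use that in \<open>auto simp: of_rat_less lows_def highs_def\<close>)
  then have O1: "negligible O1"
    unfolding O1_def by (intro negligible_countable_Union) auto
  have O2: "negligible O2"
    by (rule negligible_unbounded_slopes[OF \<open>a < b\<close> AC]) (auto simp: O2_def)
  show thesis
  proof (rule that)
    show "negligible (O1 \<union> O2 \<union> {a, b})"
      using O1 O2 by (auto intro!: negligible_Un intro: negligible_finite)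
    fix x assume x: "x \<in> {a..b} - (O1 \<union> O2 \<union> {a, b})"
    then have xab: "a < x" "x < b" by auto
    then obtain M d0 where "d0 > 0" and d0: "\<And>u v. straddles a b d0 x u v \<Longrightarrow> \<bar>F v - F u\<bar> \<le> M * (v - u)"
      using x unfolding O2_def by (auto simp: not_less)
    show "\<exists>L. (F has_real_derivative L) (at x)"
    proof (rule derivative_from_slopes[OF xab \<open>d0 > 0\<close> d0])
      fix l h :: rat assume "l < h"
      then have "\<not> (lows (real_of_rat l) x \<and> highs (real_of_rat h) x)"
        using x xab unfolding O1_def by auto
      then show "\<exists>d>0.
        (\<forall>u v. straddles a b d x u v \<longrightarrow> of_rat l * (v - u) \<le> F v - F u) \<or>
        (\<forall>u v. straddles a b d x u v \<longrightarrow> F v - F u \<le> of_rat h * (v - u))"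
        unfolding lows_def highs_def by (meson not_less)
    qed
  qed
qed

section \<open>The fundamental theorem of calculus\<close>

text \<open>The difference between a Riemann sum and \<open>F b - F a\<close> is split according to whether the tag lies
  in \<open>N\<close>. The integrand may be changed to \<open>0\<close> on \<open>N\<close>, so tags in \<open>N\<close> contribute nothing but
  increments of \<open>F\<close>.\<close>

lemma fundamental_theorem_of_calculus_absolutely_continuous:
  assumes "a \<le> b" and AC: "absolutely_continuous_on {a..b} F" and N: "negligible N"
    and der: "\<And>x. x \<in> {a..b} - N \<Longrightarrow> (F has_vector_derivative F' x) (at x within {a..b})"
  shows "(F' has_integral (F b - F a)) {a..b}"
proof -
  define G where "G x = (if x \<in> N then 0 else F' x)" for x
  have "(G has_integral (F b - F a)) {a..b}"
    unfolding has_integral_real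
  proof (intro allI impI)
    fix e :: real assume "e > 0"
    (* the summand 1 keeps the denominator positive if a = b *)
    define c where "c = e / 2 / (b - a + 1)"
    have "c > 0" using \<open>e > 0\<close> \<open>a \<le> b\<close> by (simp add: c_def)
    have cab: "c * (b - a) < e / 2"
    proof -
      have "c * (b - a) < c * (b - a + 1)" using \<open>c > 0\<close> by simp
      also have "\<dots> = e / 2"
        using \<open>a \<le> b\<close> nonzero_eq_divide_eq[of "b - a + 1" "e / 2 / (b - a + 1)" "e / 2"]
        unfolding c_def by simp
      finally show ?thesis .
    qed
    obtain \<delta> where "\<delta> > 0" and \<delta>: "\<And>p T. \<lbrakk>p division_of T; T \<subseteq> {a..b}; (\<Sum>K\<in>p. measure lebesgue K) < \<delta>\<rbrakk>
        \<Longrightarrow> (\<Sum>K\<in>p. \<bar>increment F K\<bar>) < e / 2"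
      using absolutely_continuous_on_division[OF AC, of "e / 2"] \<open>e > 0\<close> by auto
    obtain U where U: "open U" "N \<subseteq> U" "U - N \<in> lmeasurable" "emeasure lebesgue (U - N) < ennreal \<delta>"
      using sets_lebesgue_outer_open[of N \<delta>] negligible_imp_sets[OF N] \<open>\<delta> > 0\<close> by auto
    have "U = (U - N) \<union> N" using U(2) by auto
    then have Um: "U \<in> lmeasurable"
      using U(3) negligible_imp_measurable[OF N] by (metis fmeasurable.Un)
    have "measure lebesgue U \<le> measure lebesgue (U - N) + measure lebesgue N"
      using measure_Un_le[of "U - N" lebesgue N] \<open>U = (U - N) \<union> N\<close> U(3) negligible_imp_sets[OF N] by auto
    also have "\<dots> < \<delta>"
      using U(3,4) \<open>\<delta> > 0\<close> negligible_imp_measure0[OF N] by (simp add: emeasure_eq_measure2 ennreal_less_iff)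
    finally have mU: "measure lebesgue U < \<delta>" .
    have "\<exists>r>0. (x \<in> N \<longrightarrow> ball x r \<subseteq> U) \<and> (x \<in> {a..b} - N \<longrightarrow>
        (\<forall>y\<in>{a..b}. \<bar>y - x\<bar> < r \<longrightarrow> \<bar>F y - F x - (y - x) * F' x\<bar> \<le> c * \<bar>y - x\<bar>))" for x
    proof (cases "x \<in> N")
      case True
      then show ?thesis using U(1,2) open_contains_ball by (metis DiffD2 subsetD)
    next
      case False
      show ?thesis
      proof (cases "x \<in> {a..b}")
        case True
        then show ?thesis
          using der[of x] False \<open>c > 0\<close> unfolding has_vector_derivative_def has_derivative_within_alt
          by auto
      qed (use False zero_less_one in blast)
    qed
    then obtain r where r0: "\<And>x. r x > 0" and rN: "\<And>x. x \<in> N \<Longrightarrow> ball x (r x) \<subseteq> U"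
      and r: "\<And>x y. \<lbrakk>x \<in> {a..b} - N; y \<in> {a..b}; \<bar>y - x\<bar> < r x\<rbrakk>
          \<Longrightarrow> \<bar>F y - F x - (y - x) * F' x\<bar> \<le> c * \<bar>y - x\<bar>"
      by metis
    show "\<exists>\<gamma>. gauge \<gamma> \<and> (\<forall>\<D>. \<D> tagged_division_of {a..b} \<and> \<gamma> fine \<D> \<longrightarrow>
        norm ((\<Sum>(x, K)\<in>\<D>. measure lborel K *\<^sub>R G x) - (F b - F a)) < e)"
    proof (intro exI[of _ "\<lambda>x. ball x (r x)"] conjI allI impI)
      show "gauge (\<lambda>x. ball x (r x))"
        using r0 gauge_ball_dependent by blast
      fix p assume "p tagged_division_of {a..b} \<and> (\<lambda>x. ball x (r x)) fine p"
      then have p: "p tagged_division_of {a..b}" and fine: "(\<lambda>x. ball x (r x)) fine p" by auto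
      have elem: "\<exists>u v. K = {u..v} \<and> u \<le> x \<and> x \<le> v \<and> a \<le> u \<and> v \<le> b \<and> K \<subseteq> ball x (r x)" if xK: "(x, K) \<in> p" for x K
      proof -
        obtain u v where K: "K = cbox u v" using tagged_division_ofD(4)[OF p xK] by blast
        moreover have "x \<in> K" "K \<subseteq> {a..b}"
          using tagged_division_ofD(2,3)[OF p xK] by auto
        moreover have "K \<subseteq> ball x (r x)"
          using fine xK by blast
        ultimately show ?thesis by (intro exI[of _ u] exI[of _ v]) auto
      qed
      let ?err = "\<lambda>(x, K). measure lborel K *\<^sub>R G x - increment F K"
      define q where "q = {(x, K) \<in> p. x \<in> N}"
      have qp: "q \<subseteq> p" unfolding q_def by auto
      have fin: "finite p" using p by blast
      have "\<bar>sum ?err q\<bar> < e / 2"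
      proof -
        have "q tagged_partial_division_of {a..b}"
          using p qp tagged_partial_division_subset unfolding tagged_division_of_def by blast
        then have q: "q tagged_division_of \<Union>(snd ` q)"
          by (rule tagged_partial_division_of_Union_self)
        then have sq: "snd ` q division_of \<Union>(snd ` q)"
          by (rule division_of_tagged_division)
        have sub: "\<Union>(snd ` q) \<subseteq> {a..b}" "\<Union>(snd ` q) \<subseteq> U"
          using elem rN unfolding q_def by fastforce+
        have "(\<Sum>K\<in>snd ` q. measure lebesgue K) \<le> measure lebesgue U"
          unfolding content_division[OF sq]
          using sub(2) lmeasurable_division[OF sq] Um by (intro measure_mono_fmeasurable) auto
        then have small: "(\<Sum>K\<in>snd ` q. \<bar>increment F K\<bar>) < e / 2"
          using mU by (intro \<delta>[OF sq sub(1)]) simp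
        (* tags can be dropped from a sum if the summand vanishes on intervals without interior;
           Sup and Inf of the empty interval are arbitrary, hence the case distinction *)
        let ?d = "\<lambda>K::real set. if K = {} then 0 else \<bar>increment F K\<bar>"
        have "\<bar>sum ?err q\<bar> \<le> (\<Sum>z\<in>q. \<bar>?err z\<bar>)"
          by (rule sum_abs)
        also have "\<dots> = (\<Sum>(x, K)\<in>q. ?d K)"
        proof (rule sum.cong[OF refl])
          fix z assume "z \<in> q"
          then obtain x K where z: "z = (x, K)" "(x, K) \<in> p" "x \<in> N" unfolding q_def by auto
          then have "K \<noteq> {}" using elem by fastforce
          with z show "\<bar>?err z\<bar> = (case z of (x, K) \<Rightarrow> ?d K)" by (simp add: G_def)
        qed
        also have "\<dots> = (\<Sum>K\<in>snd ` q. ?d K)"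
        proof (rule sum.over_tagged_division_lemma[OF q])
          fix u v :: real assume "box u v = {}"
          then have "v \<le> u" by (simp add: box_real)
          then show "?d (cbox u v) = 0" by (cases "u = v") auto
        qed
        also have "\<dots> \<le> (\<Sum>K\<in>snd ` q. \<bar>increment F K\<bar>)"
          by (rule sum_mono) auto
        finally show ?thesis using small by linarith
      qed
      moreover have "\<bar>sum ?err (p - q)\<bar> \<le> c * (b - a)"
      proof -
        have "\<bar>?err z\<bar> \<le> (case z of (x, K) \<Rightarrow> c * (Sup K - Inf K))" if zq: "z \<in> p - q" for z
        proof -
          obtain x K where z: "z = (x, K)" "(x, K) \<in> p" "x \<notin> N" using zq unfolding q_def by auto
          obtain u v where uv: "K = {u..v}" "u \<le> x" "x \<le> v" "a \<le> u" "v \<le> b" and ball: "K \<subseteq> ball x (r x)"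
            using elem[OF z(2)] by blast
          have "u \<in> ball x (r x)" "v \<in> ball x (r x)"
            using subsetD[OF ball, of u] subsetD[OF ball, of v] uv by simp_all
          then have "\<bar>F u - F x - (u - x) * F' x\<bar> \<le> c * (x - u)" "\<bar>F v - F x - (v - x) * F' x\<bar> \<le> c * (v - x)"
            using uv z(3) r[of x u] r[of x v] by (simp_all add: dist_real_def)
          then have "\<bar>(F u - F x - (u - x) * F' x) - (F v - F x - (v - x) * F' x)\<bar> \<le> c * (x - u) + c * (v - x)"
            using uv by linarith
          moreover have "(F u - F x - (u - x) * F' x) - (F v - F x - (v - x) * F' x) = (v - u) * F' x - (F v - F u)"
            "c * (x - u) + c * (v - x) = c * (v - u)"
            by (simp_all add: algebra_simps)
          ultimately show ?thesis
            using z uv by (simp add: G_def)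
        qed
        then have "\<bar>sum ?err (p - q)\<bar> \<le> (\<Sum>(x, K)\<in>p - q. c * (Sup K - Inf K))"
          by (intro order_trans[OF sum_abs] sum_mono) auto
        also have "\<dots> \<le> (\<Sum>(x, K)\<in>p. c * (Sup K - Inf K))"
        proof (rule sum_mono2[OF fin])
          fix z assume "z \<in> p - (p - q)"
          then obtain x K where "z = (x, K)" "(x, K) \<in> p" by (cases z) auto
          moreover from elem[OF this(2)] have "Inf K \<le> Sup K" by fastforce
          ultimately show "0 \<le> (case z of (x, K) \<Rightarrow> c * (Sup K - Inf K))"
            using \<open>c > 0\<close> by simp
        qed auto
        also have "\<dots> = c * (b - a)"
          using additive_tagged_division_1[OF \<open>a \<le> b\<close> p, of "\<lambda>x. x"]
          by (simp add: sum_distrib_left[symmetric] split_def)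
        finally show ?thesis .
      qed
      moreover have "sum ?err p = sum ?err q + sum ?err (p - q)"
        using sum.subset_diff[OF qp fin, of ?err] by simp
      ultimately have "\<bar>sum ?err p\<bar> < e"
        using cab by linarith
      moreover have "sum ?err p = (\<Sum>(x, K)\<in>p. measure lborel K *\<^sub>R G x) - (F b - F a)"
        using additive_tagged_division_1[OF \<open>a \<le> b\<close> p, of F] by (simp add: split_def sum_subtractf)
      ultimately show "norm ((\<Sum>(x, K)\<in>p. measure lborel K *\<^sub>R G x) - (F b - F a)) < e"
        by simp
    qed
  qed
  then show ?thesis
    by (rule has_integral_spike[OF N, rotated]) (simp add: G_def)
qed

lemma absolutely_continuous_on_subset:
  assumes "absolutely_continuous_on S F" "T \<subseteq> S"
  shows "absolutely_continuous_on T F"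
  unfolding absolutely_continuous_on_def
proof (intro allI impI)
  fix \<epsilon> :: real assume "\<epsilon> > 0"
  from assms(1)[unfolded absolutely_continuous_on_def, THEN spec, THEN mp, OF this]
  obtain \<delta> where "\<delta> > 0" and \<delta>: "\<forall>D :: (real \<times> real) set.
      finite D \<and> (\<forall>(u, v)\<in>D. u \<le> v \<and> {u..v} \<subseteq> S) \<and>
      disjoint_family_on (\<lambda>(u, v). {u<..<v}) D \<and>
      (\<Sum>(u, v)\<in>D. v - u) < \<delta> \<longrightarrow> (\<Sum>(u, v)\<in>D. \<bar>F v - F u\<bar>) < \<epsilon>"
    by (elim exE conjE) (rule that)
  show "\<exists>\<delta>>0. \<forall>D :: (real \<times> real) set.
      finite D \<and> (\<forall>(u, v)\<in>D. u \<le> v \<and> {u..v} \<subseteq> T) \<and>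
      disjoint_family_on (\<lambda>(u, v). {u<..<v}) D \<and>
      (\<Sum>(u, v)\<in>D. v - u) < \<delta> \<longrightarrow> (\<Sum>(u, v)\<in>D. \<bar>F v - F u\<bar>) < \<epsilon>"
  proof (intro exI conjI allI impI)
    show "\<delta> > 0" by fact
    fix D :: "(real \<times> real) set"
    assume D: "finite D \<and> (\<forall>(u, v)\<in>D. u \<le> v \<and> {u..v} \<subseteq> T) \<and>
      disjoint_family_on (\<lambda>(u, v). {u<..<v}) D \<and> (\<Sum>(u, v)\<in>D. v - u) < \<delta>"
    then have "\<forall>(u, v)\<in>D. u \<le> v \<and> {u..v} \<subseteq> S"
      using assms(2) by fast
    with D show "(\<Sum>(u, v)\<in>D. \<bar>F v - F u\<bar>) < \<epsilon>"
      using \<delta>[THEN spec[of _ D]] by simp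
  qed
qed

lemma absolutely_continuous_on_imp_continuous_on:
  assumes AC: "absolutely_continuous_on {a..b} F"
  shows "continuous_on {a..b} F"
  unfolding continuous_on_iff
proof (intro ballI allI impI)
  fix x e :: real assume x: "x \<in> {a..b}" and "e > 0"
  obtain \<delta> where "\<delta> > 0" and \<delta>: "\<And>p T. \<lbrakk>p division_of T; T \<subseteq> {a..b}; (\<Sum>K\<in>p. measure lebesgue K) < \<delta>\<rbrakk>
      \<Longrightarrow> (\<Sum>K\<in>p. \<bar>increment F K\<bar>) < e"
    using absolutely_continuous_on_division[OF AC \<open>e > 0\<close>] by blast
  have step: "\<bar>F v - F u\<bar> < e" if "u \<le> v" "a \<le> u" "v \<le> b" "v - u < \<delta>" for u v
  proof -
    have "{{u..v}} division_of {u..v}"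
      using that(1) division_of_self[of u v] by simp
    from \<delta>[OF this] that show ?thesis by simp
  qed
  have "dist (F y) (F x) < e" if "y \<in> {a..b}" "dist y x < \<delta>" for y
    using step[of x y] step[of y x] that x
    by (cases "x \<le> y") (auto simp: dist_real_def abs_minus_commute)
  then show "\<exists>d>0. \<forall>y\<in>{a..b}. dist y x < d \<longrightarrow> dist (F y) (F x) < e"
    using \<open>\<delta> > 0\<close> by blast
qed

text \<open>On an interval of length below \<open>\<delta>\<close> the integrals of \<open>F'\<close> over the members of a division are
  increments of \<open>F\<close>, whose absolute values sum to less than \<open>1\<close>. So \<open>F'\<close> is absolutely integrable on
  short intervals, and these are glued together.\<close>

lemma derivative_absolutely_integrable:
  assumes "a \<le> b" and AC: "absolutely_continuous_on {a..b} F" and N: "negligible N"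
    and der: "\<And>x. x \<in> {a..b} - N \<Longrightarrow> (F has_vector_derivative F' x) (at x within {a..b})"
  shows "F' absolutely_integrable_on {a..b}"
proof -
  obtain \<delta> where "\<delta> > 0" and \<delta>: "\<And>p T. \<lbrakk>p division_of T; T \<subseteq> {a..b}; (\<Sum>K\<in>p. measure lebesgue K) < \<delta>\<rbrakk>
      \<Longrightarrow> (\<Sum>K\<in>p. \<bar>increment F K\<bar>) < 1"
    using absolutely_continuous_on_division[OF AC, of 1] by auto
  have ftc: "(F' has_integral (F v - F u)) {u..v}" if "a \<le> u" "u \<le> v" "v \<le> b" for u v
  proof (rule fundamental_theorem_of_calculus_absolutely_continuous[OF that(2) _ N])
    show "absolutely_continuous_on {u..v} F"
      using that by (intro absolutely_continuous_on_subset[OF AC]) auto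
    show "(F has_vector_derivative F' x) (at x within {u..v})" if "x \<in> {u..v} - N" for x
      by (rule has_vector_derivative_within_subset[OF der])
        (use that \<open>a \<le> u\<close> \<open>v \<le> b\<close> in auto)
  qed
  have small: "F' absolutely_integrable_on {c..d}" if cd: "a \<le> c" "c \<le> d" "d \<le> b" "d - c < \<delta>" for c d
  proof -
    have "F' absolutely_integrable_on cbox c d"
    proof (rule bounded_variation_absolutely_integrable_interval)
      show "F' integrable_on cbox c d"
        using ftc[OF cd(1-3)] by auto
      fix p assume "p division_of cbox c d"
      then have p: "p division_of {c..d}" by simp
      have "(\<Sum>K\<in>p. \<bar>increment F K\<bar>) < 1"
        using content_division[OF p] cd by (intro \<delta>[OF p]) auto
      moreover have "norm (integral K F') = \<bar>increment F K\<bar>" if "K \<in> p" for K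
        by (rule division_element_real[OF p that])
          (use cd in \<open>auto intro!: arg_cong[of _ _ abs] integral_unique ftc\<close>)
      ultimately show "(\<Sum>K\<in>p. norm (integral K F')) \<le> 1"
        by simp
    qed
    then show ?thesis by simp
  qed
  (* in the local step of the induction the short interval may reach beyond [a,b], where nothing
     is known about F; hence the premises *)
  have "a \<le> a \<longrightarrow> b \<le> b \<longrightarrow> F' absolutely_integrable_on {a..b}"
    using \<open>a \<le> b\<close>
  proof (induction rule: Bolzano[where P = "\<lambda>c d. a \<le> c \<longrightarrow> d \<le> b \<longrightarrow> F' absolutely_integrable_on {c..d}"])
    case (trans c d e)
    then show ?case
      using absolutely_integrable_on_combine[of c d F' e] by auto
  next
    case (local x)
    have "F' absolutely_integrable_on {c..d}" if "a \<le> c" "d \<le> b" "c \<le> x" "x \<le> d" "d - c < \<delta>" for c d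
      using that by (intro small) auto
    then show ?case using \<open>\<delta> > 0\<close> by blast
  qed
  then show ?thesis by simp
qed

lemma Lipschitz_if_C1_on_interval:
  assumes der: "\<And>x. x \<in> {a..b} \<Longrightarrow> (f has_real_derivative f' x) (at x within {a..b})"
    and f': "continuous_on {a..b} f'"
  obtains C where "C > 0" "\<And>u v. u \<in> {a..b} \<Longrightarrow> v \<in> {a..b} \<Longrightarrow> \<bar>f v - f u\<bar> \<le> C * \<bar>v - u\<bar>"
proof -
  have "bounded (f' ` {a..b})"
    using compact_continuous_image[OF f'] compact_imp_bounded by blast
  then obtain C where C: "C > 0" "\<And>x. x \<in> {a..b} \<Longrightarrow> norm (f' x) \<le> C"
    unfolding bounded_pos by auto
  show thesis
    using field_differentiable_bound[of "{a..b}" f f' C] der C by (intro that[of C]) auto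
qed

text \<open>This follows from \<open>f v * F v - f u * F u = f v * (F v - F u) + F u * (f v - f u)\<close>, as \<open>f\<close> and \<open>F\<close>
  are bounded.\<close>

lemma absolutely_continuous_on_mult_Lipschitz:
  assumes AC: "absolutely_continuous_on {a..b} F"
    and f: "\<And>u v. u \<in> {a..b} \<Longrightarrow> v \<in> {a..b} \<Longrightarrow> \<bar>f v - f u\<bar> \<le> C * \<bar>v - u\<bar>" and "C > 0"
    and Mf: "\<And>x. x \<in> {a..b} \<Longrightarrow> \<bar>f x\<bar> \<le> M"
  shows "absolutely_continuous_on {a..b} (\<lambda>x. f x * F x)"
  unfolding absolutely_continuous_on_def
proof (intro allI impI)
  fix \<epsilon> :: real assume "\<epsilon> > 0"
  have "bounded (F ` {a..b})"
    using compact_continuous_image[OF absolutely_continuous_on_imp_continuous_on[OF AC]] compact_imp_bounded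
    by blast
  then obtain B where B: "B > 0" "\<And>x. x \<in> {a..b} \<Longrightarrow> \<bar>F x\<bar> \<le> B"
    unfolding bounded_pos by auto
  define A where "A = \<bar>M\<bar> + 1"
  have A: "A > 0" "\<And>x. x \<in> {a..b} \<Longrightarrow> \<bar>f x\<bar> \<le> A"
    using Mf by (auto simp: A_def) (meson abs_ge_self add_increasing2 order_trans zero_le_one)
  have "\<epsilon> / (2 * A) > 0" using \<open>\<epsilon> > 0\<close> A(1) by simp
  from AC[unfolded absolutely_continuous_on_def, THEN spec, THEN mp, OF this]
  obtain \<delta> where "\<delta> > 0" and \<delta>: "\<forall>D :: (real \<times> real) set.
      finite D \<and> (\<forall>(u, v)\<in>D. u \<le> v \<and> {u..v} \<subseteq> {a..b}) \<and>
      disjoint_family_on (\<lambda>(u, v). {u<..<v}) D \<and>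
      (\<Sum>(u, v)\<in>D. v - u) < \<delta> \<longrightarrow> (\<Sum>(u, v)\<in>D. \<bar>F v - F u\<bar>) < \<epsilon> / (2 * A)"
    by (elim exE conjE) (rule that)
  define \<rho> where "\<rho> = min \<delta> (\<epsilon> / (2 * (B * C)))"
  have "\<rho> > 0" using \<open>\<delta> > 0\<close> \<open>\<epsilon> > 0\<close> B(1) \<open>C > 0\<close> by (simp add: \<rho>_def)
  have "(\<Sum>(u, v)\<in>D. \<bar>f v * F v - f u * F u\<bar>) < \<epsilon>"
    if "finite D" and D: "\<forall>(u, v)\<in>D. u \<le> v \<and> {u..v} \<subseteq> {a..b}"
      and "disjoint_family_on (\<lambda>(u, v). {u<..<v}) D" and sm: "(\<Sum>(u, v)\<in>D. v - u) < \<rho>"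
    for D :: "(real \<times> real) set"
  proof -
    have F: "(\<Sum>(u, v)\<in>D. \<bar>F v - F u\<bar>) < \<epsilon> / (2 * A)"
      using \<delta>[THEN spec[of _ D]] that by (simp add: \<rho>_def)
    have "(\<Sum>(u, v)\<in>D. \<bar>f v * F v - f u * F u\<bar>) \<le> (\<Sum>(u, v)\<in>D. A * \<bar>F v - F u\<bar> + B * C * (v - u))"
    proof (rule sum_mono, clarify)
      fix u v assume "(u, v) \<in> D"
      then have uv: "u \<le> v" "u \<in> {a..b}" "v \<in> {a..b}"
        using D by fastforce+
      have "f v * F v - f u * F u = f v * (F v - F u) + F u * (f v - f u)"
        by (simp add: algebra_simps)
      then have "\<bar>f v * F v - f u * F u\<bar> \<le> \<bar>f v\<bar> * \<bar>F v - F u\<bar> + \<bar>F u\<bar> * \<bar>f v - f u\<bar>"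
        by (metis abs_mult abs_triangle_ineq)
      also have "\<dots> \<le> A * \<bar>F v - F u\<bar> + B * (C * \<bar>v - u\<bar>)"
        using A B(2)[OF uv(2)] f[OF uv(2,3)] uv B(1) by (intro add_mono mult_mono) auto
      finally show "\<bar>f v * F v - f u * F u\<bar> \<le> A * \<bar>F v - F u\<bar> + B * C * (v - u)"
        using uv(1) by (simp add: mult.assoc)
    qed
    also have "\<dots> = A * (\<Sum>(u, v)\<in>D. \<bar>F v - F u\<bar>) + B * C * (\<Sum>(u, v)\<in>D. v - u)"
      by (simp add: split_def sum.distrib sum_distrib_left)
    also have "\<dots> < A * (\<epsilon> / (2 * A)) + B * C * (\<epsilon> / (2 * (B * C)))"
      using F sm A(1) B(1) \<open>C > 0\<close> by (intro add_strict_mono mult_strict_left_mono) (auto simp: \<rho>_def)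
    also have "\<dots> = \<epsilon>"
      using A(1) B(1) \<open>C > 0\<close> by (simp add: field_simps)
    finally show ?thesis .
  qed
  then show "\<exists>\<delta>>0. \<forall>D :: (real \<times> real) set.
      finite D \<and> (\<forall>(u, v)\<in>D. u \<le> v \<and> {u..v} \<subseteq> {a..b}) \<and>
      disjoint_family_on (\<lambda>(u, v). {u<..<v}) D \<and>
      (\<Sum>(u, v)\<in>D. v - u) < \<delta> \<longrightarrow> (\<Sum>(u, v)\<in>D. \<bar>f v * F v - f u * F u\<bar>) < \<epsilon>"
    using \<open>\<rho> > 0\<close> by blast
qed

lemma integration_by_parts_absolutely_continuous:
  assumes "a < b" and AC: "absolutely_continuous_on {a..b} F"
    and f: "\<And>x. x \<in> {a..b} \<Longrightarrow> (f has_real_derivative f' x) (at x within {a..b})"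
    and f': "continuous_on {a..b} f'"
  defines "F' \<equiv> \<lambda>t. vector_derivative F (at t within {a..b})"
  shows "set_integrable lebesgue {a..b} (\<lambda>t. f t * F' t)"
    and "(LINT t:{a..b}|lebesgue. f t * F' t) = f b * F b - f a * F a - (LINT t:{a..b}|lebesgue. f' t * F t)"
proof -
  obtain N where N: "negligible N" "\<And>x. x \<in> {a..b} - N \<Longrightarrow> \<exists>L. (F has_real_derivative L) (at x)"
    using absolutely_continuous_on_differentiable_ae[OF \<open>a < b\<close> AC] by blast
  have F': "(F has_vector_derivative F' x) (at x within {a..b})" if x: "x \<in> {a..b} - N" for x
  proof -
    obtain L where "(F has_real_derivative L) (at x)" using N(2)[OF x] by blast
    then have L: "(F has_vector_derivative L) (at x within {a..b})"
      by (simp add: has_real_derivative_iff_has_vector_derivative has_vector_derivative_at_within)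
    moreover have "F' x = L"
      unfolding F'_def using vector_derivative_within_closed_interval[OF \<open>a < b\<close> _ L] x by blast
    ultimately show ?thesis by simp
  qed
  have cf: "continuous_on {a..b} f"
    using f by (rule DERIV_continuous_on)
  then have bf: "bounded (f ` {a..b})"
    using compact_continuous_image compact_imp_bounded by blast
  then obtain M where "\<forall>y\<in>f ` {a..b}. norm y \<le> M"
    unfolding bounded_iff by blast
  then have M: "\<And>x. x \<in> {a..b} \<Longrightarrow> \<bar>f x\<bar> \<le> M"
    by auto
  obtain C where C: "C > 0" "\<And>u v. u \<in> {a..b} \<Longrightarrow> v \<in> {a..b} \<Longrightarrow> \<bar>f v - f u\<bar> \<le> C * \<bar>v - u\<bar>"
    using Lipschitz_if_C1_on_interval[OF f f'] by blast
  have ab: "a \<le> b" using \<open>a < b\<close> by simp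
  have "F' absolutely_integrable_on {a..b}"
    by (rule derivative_absolutely_integrable[OF ab AC N(1) F'])
  then show int1: "set_integrable lebesgue {a..b} (\<lambda>t. f t * F' t)"
    by (intro absolutely_integrable_bounded_measurable_product_real bf
        continuous_imp_measurable_on_sets_lebesgue cf) auto
  have int2: "set_integrable lebesgue {a..b} (\<lambda>t. f' t * F t)"
    by (intro absolutely_integrable_continuous_real continuous_on_mult f'
        absolutely_continuous_on_imp_continuous_on[OF AC])
  have ftc: "((\<lambda>t. f t * F' t + f' t * F t) has_integral (f b * F b - f a * F a)) {a..b}"
  proof (rule fundamental_theorem_of_calculus_absolutely_continuous[OF ab _ N(1)])
    show "absolutely_continuous_on {a..b} (\<lambda>x. f x * F x)"
      by (rule absolutely_continuous_on_mult_Lipschitz[OF AC C(2,1) M])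
    fix x assume x: "x \<in> {a..b} - N"
    show "((\<lambda>x. f x * F x) has_vector_derivative f x * F' x + f' x * F x) (at x within {a..b})"
      using has_vector_derivative_mult[OF _ F'[OF x], of f "f' x"] f[of x] x
      by (simp add: has_real_derivative_iff_has_vector_derivative)
  qed
  have "((\<lambda>t. f t * F' t + f' t * F t) has_integral
      (LINT t:{a..b}|lebesgue. f t * F' t) + (LINT t:{a..b}|lebesgue. f' t * F t)) {a..b}"
    by (intro has_integral_add has_integral_set_lebesgue int1 int2)
  from has_integral_unique[OF ftc this]
  show "(LINT t:{a..b}|lebesgue. f t * F' t) = f b * F b - f a * F a - (LINT t:{a..b}|lebesgue. f' t * F t)"
    by simp
qed

section \<open>Fubini's theorem for Lebesgue measurable functions\<close>

lemma lebesgue_integral_AE_borel: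
  fixes f g :: "'a::euclidean_space \<Rightarrow> real"
  assumes g: "g \<in> borel_measurable borel" and ae: "AE x in lborel. f x = g x"
  shows "integral\<^sup>L lebesgue f = integral\<^sup>L lborel g"
    and "integrable lebesgue f \<longleftrightarrow> integrable lborel g"
proof -
  have gl: "g \<in> borel_measurable lebesgue"
    using g by (simp add: measurable_completion)
  have ae': "AE x in lebesgue. f x = g x"
    using ae by (rule AE_completion)
  have fl: "f \<in> borel_measurable lebesgue"
    by (rule borel_measurable_AE[OF gl]) (use ae' in \<open>auto elim: AE_mp\<close>)
  show "integral\<^sup>L lebesgue f = integral\<^sup>L lborel g"
    using integral_cong_AE[OF fl gl ae'] g by (simp add: integral_completion)
  show "integrable lebesgue f \<longleftrightarrow> integrable lborel g"
    using integrable_cong_AE[OF fl gl ae'] g by (simp add: integrable_completion)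
qed

text \<open>The Lebesgue measure on the plane is the completion of a product measure, not a product
  measure. A Lebesgue measurable function therefore is replaced by a Borel function \<open>g\<close> that agrees
  with it almost everywhere; almost all sections of the two then agree almost everywhere as well.\<close>

lemma lebesgue_Fubini:
  fixes f :: "real \<times> real \<Rightarrow> real"
  assumes f: "integrable lebesgue f"
  shows "integrable lebesgue (\<lambda>x. LINT y|lebesgue. f (x, y))"
    and "integrable lebesgue (\<lambda>y. LINT x|lebesgue. f (x, y))"
    and "(LINT x|lebesgue. LINT y|lebesgue. f (x, y)) = (LINT y|lebesgue. LINT x|lebesgue. f (x, y))"
proof -
  obtain g where "g \<in> borel_measurable lborel" and ae: "AE p in lborel. f p = g p"
    using completion_ex_borel_measurable_real[OF borel_measurable_integrable[OF f]] by blast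
  then have gb: "g \<in> borel_measurable borel" by simp
  then have gm[measurable]: "g \<in> borel_measurable (lborel \<Otimes>\<^sub>M lborel)"
    by (simp add: lborel_prod)
  have gi: "integrable (lborel \<Otimes>\<^sub>M lborel) g"
    using lebesgue_integral_AE_borel(2)[OF gb ae] f by (simp add: lborel_prod)
  have gi': "integrable (lborel \<Otimes>\<^sub>M lborel) (\<lambda>(x, y). g (x, y))"
    using gi by simp
  obtain N where N: "{p \<in> space lborel. f p \<noteq> g p} \<subseteq> N" "N \<in> sets lborel" "emeasure lborel N = 0"
    using ae by (rule AE_E)
  have Nm: "N \<in> sets (lborel \<Otimes>\<^sub>M lborel)"
    using N(2) by (simp only: lborel_prod)
  have "AE p in lborel \<Otimes>\<^sub>M lborel. p \<notin> N"
    unfolding lborel_prod using N(2,3) by (intro AE_not_in) (auto simp: null_sets_def)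
  then have x: "AE x in lborel. AE y in lborel. (x, y) \<notin> N"
    by (rule lborel_pair.AE_pair)
  moreover have "{p \<in> space (lborel \<Otimes>\<^sub>M lborel). (fst p, snd p) \<notin> N} \<in> sets (lborel \<Otimes>\<^sub>M lborel)"
    using Nm by measurable
  ultimately have y: "AE y in lborel. AE x in lborel. (x, y) \<notin> N"
    using lborel_pair.AE_commute[of "\<lambda>x y. (x, y) \<notin> N"] by simp
  have eq: "f p = g p" if "p \<notin> N" for p
    using N(1) that by auto
  have X: "AE x in lborel. (LINT y|lebesgue. f (x, y)) = (LINT y|lborel. g (x, y))"
    using x
  proof eventually_elim
    case (elim x)
    show ?case
    proof (rule lebesgue_integral_AE_borel(1))
      show "(\<lambda>y. g (x, y)) \<in> borel_measurable borel"
        using gb by measurable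
      show "AE y in lborel. f (x, y) = g (x, y)"
        using elim by eventually_elim (rule eq)
    qed
  qed
  have Y: "AE y in lborel. (LINT x|lebesgue. f (x, y)) = (LINT x|lborel. g (x, y))"
    using y
  proof eventually_elim
    case (elim y)
    show ?case
    proof (rule lebesgue_integral_AE_borel(1))
      show "(\<lambda>x. g (x, y)) \<in> borel_measurable borel"
        using gb by measurable
      show "AE x in lborel. f (x, y) = g (x, y)"
        using elim by eventually_elim (rule eq)
    qed
  qed
  have Xi: "integrable lborel (\<lambda>x. LINT y|lborel. g (x, y))"
    by (rule lborel_pair.integrable_fst[OF gi'])
  have Yi: "integrable lborel (\<lambda>y. LINT x|lborel. g (x, y))"
    by (rule lborel_pair.integrable_snd[OF gi'])
  have Xm: "(\<lambda>x. LINT y|lborel. g (x, y)) \<in> borel_measurable borel"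
    and Ym: "(\<lambda>y. LINT x|lborel. g (x, y)) \<in> borel_measurable borel"
    using borel_measurable_integrable[OF Xi] borel_measurable_integrable[OF Yi] by simp_all
  show "integrable lebesgue (\<lambda>x. LINT y|lebesgue. f (x, y))"
    using lebesgue_integral_AE_borel(2)[OF Xm X] Xi by simp
  show "integrable lebesgue (\<lambda>y. LINT x|lebesgue. f (x, y))"
    using lebesgue_integral_AE_borel(2)[OF Ym Y] Yi by simp
  show "(LINT x|lebesgue. LINT y|lebesgue. f (x, y)) = (LINT y|lebesgue. LINT x|lebesgue. f (x, y))"
    using lebesgue_integral_AE_borel(1)[OF Xm X] lebesgue_integral_AE_borel(1)[OF Ym Y]
      lborel_pair.Fubini_integral[OF gi'] by simp
qed

section \<open>The kernel of variable order\<close>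

text \<open>The power of \<open>t - \<tau>\<close> is at most \<open>1\<close> if \<open>t - \<tau> \<ge> 1\<close>, and otherwise it grows with the order.
  The factor \<open>1 / \<Gamma> (1 - \<alpha>)\<close> is a value of the continuous function \<^const>\<open>rGamma\<close> on \<open>[0,1]\<close>.\<close>

lemma vo_kernel_bound:
  assumes \<gamma>: "\<forall>p\<in>order_domain a b. 0 < \<alpha> p \<and> \<alpha> p < \<gamma>" and "\<gamma> < 1"
  obtains C where "C > 0" "\<And>t \<tau>. (t, \<tau>) \<in> order_domain a b \<Longrightarrow>
      \<bar>vo_kernel \<alpha> t \<tau>\<bar> \<le> C * (1 + (t - \<tau>) powr (- \<gamma>))"
proof -
  have "continuous_on {0..1::real} rGamma"
    by (intro continuous_intros)
  then have "bounded (rGamma ` {0..1::real})"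
    using compact_continuous_image compact_imp_bounded by blast
  then obtain C where C: "C > 0" "\<And>x. x \<in> {0..1::real} \<Longrightarrow> \<bar>rGamma x\<bar> \<le> C"
    unfolding bounded_pos by auto
  show thesis
  proof (rule that[OF C(1)])
    fix t \<tau> assume p: "(t, \<tau>) \<in> order_domain a b"
    let ?s = "t - \<tau>" and ?\<alpha> = "\<alpha> (t, \<tau>)"
    have s: "?s > 0" using p by (auto simp: order_domain_def)
    have \<alpha>: "0 < ?\<alpha>" "?\<alpha> < \<gamma>" using \<gamma> p by auto
    have "?s powr (- ?\<alpha>) \<le> 1 + ?s powr (- \<gamma>)"
    proof (cases "?s \<le> 1")
      case True
      then have "?s powr (- ?\<alpha>) \<le> ?s powr (- \<gamma>)"
        using s \<alpha> by (intro powr_mono') auto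
      then show ?thesis by simp
    next
      case False
      then have "?s powr (- ?\<alpha>) \<le> ?s powr 0"
        using \<alpha> by (intro powr_mono) auto
      then show ?thesis using s by (simp add: add_increasing2)
    qed
    moreover have "\<bar>vo_kernel \<alpha> t \<tau>\<bar> = ?s powr (- ?\<alpha>) * \<bar>rGamma (1 - ?\<alpha>)\<bar>"
      by (simp add: vo_kernel_def rGamma_inverse_Gamma divide_inverse abs_mult)
    moreover have "\<bar>rGamma (1 - ?\<alpha>)\<bar> \<le> C"
      using \<alpha> \<open>\<gamma> < 1\<close> by (intro C(2)) auto
    ultimately have "\<bar>vo_kernel \<alpha> t \<tau>\<bar> \<le> (1 + ?s powr (- \<gamma>)) * C"
      by (metis abs_ge_zero mult_mono' powr_ge_zero)
    then show "\<bar>vo_kernel \<alpha> t \<tau>\<bar> \<le> C * (1 + ?s powr (- \<gamma>))"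
      by (simp add: mult.commute)
  qed
qed

text \<open>All sections in the direction of \<open>\<tau>\<close> are reflected translates of \<open>\<phi>\<close>, so their \<open>L\<^sup>1\<close> norms agree.\<close>

lemma integrable_convolution_strip:
  fixes \<phi> :: "real \<Rightarrow> real"
  assumes "integrable lborel \<phi>"
  shows "integrable lborel (\<lambda>p. indicator {a..b} (fst p) * \<phi> (fst p - snd p))"
proof -
  have [measurable]: "\<phi> \<in> borel_measurable borel"
    using borel_measurable_integrable[OF assms] by simp
  have sec: "integrable lborel (\<lambda>\<tau>. \<phi> (t - \<tau>))" "(LINT \<tau>|lborel. \<bar>\<phi> (t - \<tau>)\<bar>) = (LINT s|lborel. \<bar>\<phi> s\<bar>)" for t
    using lborel_integrable_real_affine[OF assms, of "-1" t]
      lborel_integral_real_affine[of "-1" "\<lambda>s. \<bar>\<phi> s\<bar>" t] by simp_all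
  have "integrable (lborel \<Otimes>\<^sub>M lborel) (\<lambda>p. indicator {a..b} (fst p) * \<phi> (fst p - snd p))"
  proof (rule lborel_pair.Fubini_integrable)
    show "(\<lambda>p. indicator {a..b} (fst p) * \<phi> (fst p - snd p)) \<in> borel_measurable (lborel \<Otimes>\<^sub>M lborel)"
      by measurable
    have "(\<lambda>t. LINT \<tau>|lborel. norm (indicator {a..b} (fst (t, \<tau>)) * \<phi> (fst (t, \<tau>) - snd (t, \<tau>))))
        = (\<lambda>t. indicator {a..b} t * (LINT s|lborel. \<bar>\<phi> s\<bar>))"
      by (rule ext) (simp add: abs_mult sec(2))
    moreover have "integrable lborel (\<lambda>t. indicator {a..b} t * (LINT s|lborel. \<bar>\<phi> s\<bar>))"
      by (intro integrable_mult_left) (auto simp: integrable_indicator_iff emeasure_lborel_Icc_eq)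
    ultimately show "integrable lborel (\<lambda>t. LINT \<tau>|lborel. norm (indicator {a..b} (fst (t, \<tau>)) * \<phi> (fst (t, \<tau>) - snd (t, \<tau>))))"
      by simp
    show "AE t in lborel. integrable lborel (\<lambda>\<tau>. indicator {a..b} (fst (t, \<tau>)) * \<phi> (fst (t, \<tau>) - snd (t, \<tau>)))"
      using sec(1) by (intro AE_I2) (simp add: integrable_mult_right)
  qed
  then show ?thesis
    by (simp add: lborel_prod)
qed

lemma integrable_weakly_singular:
  fixes \<gamma> c :: real
  assumes "\<gamma> < 1"
  shows "integrable lborel (\<lambda>s. indicator {0<..c} s * (1 + s powr (- \<gamma>)))"
proof (cases "c \<le> 0")
  case True
  then have "{0<..c} = {}" by auto
  then show ?thesis by simp
next
  case False
  have "(\<lambda>s. s powr (- \<gamma>)) absolutely_integrable_on {0..c}"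
    using has_integral_powr_from_0[of "- \<gamma>" c] assms False
    by (intro nonnegative_absolutely_integrable_1) auto
  then have "(\<lambda>s. 1 + s powr (- \<gamma>)) absolutely_integrable_on {0..c}"
    by (intro set_integral_add(1) absolutely_integrable_on_const) auto
  then have "(\<lambda>s. 1 + s powr (- \<gamma>)) absolutely_integrable_on {0<..c}"
    by (rule set_integrable_subset) auto
  then show ?thesis
    unfolding set_integrable_def
    by (subst (asm) integrable_completion) simp_all
qed

lemma order_domain_borel: "order_domain a b \<in> sets borel"
proof -
  have "order_domain a b = {p. a \<le> snd p} \<inter> {p. snd p < fst p} \<inter> {p. fst p \<le> b}"
    by (auto simp: order_domain_def)
  also have "\<dots> \<in> sets borel"
    by (intro sets.Int borel_closed borel_open closed_Collect_le open_Collect_less continuous_intros)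
  finally show ?thesis .
qed

text \<open>Measurability is shown on the whole plane, after \<open>\<alpha>\<close>, \<open>u\<close> and \<open>v\<close> have been set to zero outside
  their domains and \<open>1 / \<Gamma>\<close> has been replaced by \<^const>\<open>rGamma\<close>, which is continuous everywhere.\<close>

lemma variable_order_kernel_integrable:
  assumes \<alpha>: "\<alpha> \<in> borel_measurable (lebesgue_on (order_domain a b))"
    and \<gamma>: "\<forall>p\<in>order_domain a b. 0 < \<alpha> p \<and> \<alpha> p < \<gamma>" and "\<gamma> < 1"
    and u: "continuous_on {a..b} u" and v: "continuous_on {a..b} v"
  shows "integrable lebesgue (\<lambda>p. indicator (order_domain a b) p * (vo_kernel \<alpha> (fst p) (snd p) * u (fst p) * v (snd p)))"
    (is "integrable lebesgue ?\<Phi>")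
proof -
  let ?\<Delta> = "order_domain a b"
  define A where "A p = (if p \<in> ?\<Delta> then \<alpha> p else 0)" for p
  have \<Delta>: "?\<Delta> \<in> sets borel" by (rule order_domain_borel)
  have A[measurable]: "A \<in> borel_measurable lebesgue"
    using \<alpha> \<Delta> unfolding A_def by (subst borel_measurable_if) auto
  have rG[measurable]: "(rGamma :: real \<Rightarrow> real) \<in> borel_measurable borel"
    by (intro borel_measurable_continuous_onI continuous_intros)
  have fst_m[measurable]: "(fst :: real \<times> real \<Rightarrow> real) \<in> lebesgue \<rightarrow>\<^sub>M borel"
    and snd_m[measurable]: "(snd :: real \<times> real \<Rightarrow> real) \<in> lebesgue \<rightarrow>\<^sub>M borel"
    by (auto intro!: measurable_completion borel_measurable_continuous_onI continuous_intros)
  have um[measurable]: "(\<lambda>t. indicator {a..b} t * u t) \<in> borel_measurable borel"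
    and vm[measurable]: "(\<lambda>t. indicator {a..b} t * v t) \<in> borel_measurable borel"
    using borel_measurable_continuous_on_indicator[OF _ u] borel_measurable_continuous_on_indicator[OF _ v] by auto
  have \<Delta>m[measurable]: "?\<Delta> \<in> sets lebesgue"
    using \<Delta> by auto
  have inab: "fst p \<in> {a..b}" "snd p \<in> {a..b}" if "p \<in> ?\<Delta>" for p
    using that by (auto simp: order_domain_def)
  have "?\<Phi> = (\<lambda>p. indicator ?\<Delta> p * ((fst p - snd p) powr (- A p) * rGamma (1 - A p)
      * (indicator {a..b} (fst p) * u (fst p)) * (indicator {a..b} (snd p) * v (snd p))))"
    using inab by (auto simp: fun_eq_iff A_def vo_kernel_def rGamma_inverse_Gamma divide_inverse indicator_def)
  also have "\<dots> \<in> borel_measurable lebesgue"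
    using um vm by measurable
  finally have \<Phi>m: "?\<Phi> \<in> borel_measurable lebesgue" .
  obtain C where C: "C > 0" "\<And>t \<tau>. (t, \<tau>) \<in> ?\<Delta> \<Longrightarrow>
      \<bar>vo_kernel \<alpha> t \<tau>\<bar> \<le> C * (1 + (t - \<tau>) powr (- \<gamma>))"
    using vo_kernel_bound[OF \<gamma> \<open>\<gamma> < 1\<close>] by blast
  have "bounded (u ` {a..b})" "bounded (v ` {a..b})"
    using compact_continuous_image[OF u] compact_continuous_image[OF v] compact_imp_bounded by blast+
  then obtain Mu Mv where "Mu > 0" "\<forall>y\<in>u ` {a..b}. norm y \<le> Mu" "Mv > 0" "\<forall>y\<in>v ` {a..b}. norm y \<le> Mv"
    unfolding bounded_pos by blast
  then have M: "Mu > 0" "\<And>x. x \<in> {a..b} \<Longrightarrow> \<bar>u x\<bar> \<le> Mu" "Mv > 0" "\<And>x. x \<in> {a..b} \<Longrightarrow> \<bar>v x\<bar> \<le> Mv"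
    by auto
  define \<phi> where "\<phi> s = indicator {0<..b - a} s * (1 + s powr (- \<gamma>))" for s :: real
  define B where "B p = C * Mu * Mv * (indicator {a..b} (fst p) * \<phi> (fst p - snd p))" for p
  have "integrable lborel \<phi>"
    unfolding \<phi>_def by (rule integrable_weakly_singular[OF \<open>\<gamma> < 1\<close>])
  then have "integrable lborel B"
    unfolding B_def by (intro integrable_mult_right integrable_convolution_strip)
  then have Bi: "integrable lebesgue B"
    using integrable_completion[of B lborel] borel_measurable_integrable by blast
  show ?thesis
  proof (rule Bochner_Integration.integrable_bound[OF Bi \<Phi>m], rule AE_I2)
    fix p :: "real \<times> real"
    show "norm (?\<Phi> p) \<le> norm (B p)"
    proof (cases "p \<in> ?\<Delta>")
      case True
      obtain t \<tau> where p: "p = (t, \<tau>)" by (cases p)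
      have d: "(t, \<tau>) \<in> ?\<Delta>" "t \<in> {a..b}" "\<tau> \<in> {a..b}" "t - \<tau> \<in> {0<..b - a}"
        using True p by (auto simp: order_domain_def)
      have "\<bar>vo_kernel \<alpha> t \<tau>\<bar> * \<bar>u t\<bar> * \<bar>v \<tau>\<bar> \<le> (C * (1 + (t - \<tau>) powr (- \<gamma>))) * Mu * Mv"
        using C M d by (intro mult_mono) (auto intro!: mult_nonneg_nonneg)
      also have "\<dots> = B p"
        using d p by (simp add: B_def \<phi>_def)
      finally show ?thesis
        using d p by (simp add: abs_mult mult.assoc)
    qed simp
  qed
qed

section \<open>Exchange of the fractional integrals and integration by parts\<close>

text \<open>The two sides are the iterated integrals, in either order, of \<open>u t * k t \<tau> * v \<tau>\<close> over the
  triangle \<open>a \<le> \<tau> < t \<le> b\<close>.\<close>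

lemma variable_order_integrals_exchange:
  assumes \<alpha>: "\<alpha> \<in> borel_measurable (lebesgue_on (order_domain a b))"
    and \<gamma>: "\<forall>p\<in>order_domain a b. 0 < \<alpha> p \<and> \<alpha> p < \<gamma>" and "\<gamma> < 1"
    and u: "continuous_on {a..b} u" and v: "continuous_on {a..b} v"
  shows "set_integrable lebesgue {a..b} (\<lambda>t. u t * left_RL_integral a \<alpha> v t)"
    and "set_integrable lebesgue {a..b} (\<lambda>\<tau>. v \<tau> * right_RL_integral b \<alpha> u \<tau>)"
    and "(LINT t:{a..b}|lebesgue. u t * left_RL_integral a \<alpha> v t)
      = (LINT \<tau>:{a..b}|lebesgue. v \<tau> * right_RL_integral b \<alpha> u \<tau>)"
proof -
  let ?\<Delta> = "order_domain a b"
  define \<Phi> where "\<Phi> p = indicator ?\<Delta> p * (vo_kernel \<alpha> (fst p) (snd p) * u (fst p) * v (snd p))" for p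
  have \<Phi>: "integrable lebesgue \<Phi>"
    unfolding \<Phi>_def by (rule variable_order_kernel_integrable[OF assms])
  have X: "(LINT \<tau>|lebesgue. \<Phi> (t, \<tau>)) = indicator {a..b} t *\<^sub>R (u t * left_RL_integral a \<alpha> v t)" for t
  proof (cases "t \<in> {a..b}")
    case True
    then have "\<Phi> (t, \<tau>) = u t * (indicator {a..<t} \<tau> *\<^sub>R (vo_kernel \<alpha> t \<tau> * v \<tau>))" for \<tau>
      by (auto simp: \<Phi>_def order_domain_def indicator_def)
    then show ?thesis
      using True by (simp add: left_RL_integral_def set_lebesgue_integral_def)
  next
    case False
    then have "\<Phi> (t, \<tau>) = 0" for \<tau>
      by (auto simp: \<Phi>_def order_domain_def indicator_def)
    then show ?thesis using False by simp
  qed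
  have Y: "(LINT t|lebesgue. \<Phi> (t, \<tau>)) = indicator {a..b} \<tau> *\<^sub>R (v \<tau> * right_RL_integral b \<alpha> u \<tau>)" for \<tau>
  proof (cases "\<tau> \<in> {a..b}")
    case True
    then have "\<Phi> (t, \<tau>) = v \<tau> * (indicator {\<tau><..b} t *\<^sub>R (vo_kernel \<alpha> t \<tau> * u t))" for t
      by (auto simp: \<Phi>_def order_domain_def indicator_def)
    then show ?thesis
      using True by (simp add: right_RL_integral_def set_lebesgue_integral_def)
  next
    case False
    then have "\<Phi> (t, \<tau>) = 0" for t
      by (auto simp: \<Phi>_def order_domain_def indicator_def)
    then show ?thesis using False by simp
  qed
  show "set_integrable lebesgue {a..b} (\<lambda>t. u t * left_RL_integral a \<alpha> v t)"
    and "set_integrable lebesgue {a..b} (\<lambda>\<tau>. v \<tau> * right_RL_integral b \<alpha> u \<tau>)"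
    and "(LINT t:{a..b}|lebesgue. u t * left_RL_integral a \<alpha> v t)
      = (LINT \<tau>:{a..b}|lebesgue. v \<tau> * right_RL_integral b \<alpha> u \<tau>)"
    using lebesgue_Fubini[OF \<Phi>] unfolding X Y set_integrable_def set_lebesgue_integral_def by simp_all
qed

lemma Caputo_deriv_eq_RL_integral:
  assumes "a < b" and f: "\<And>x. x \<in> {a..b} \<Longrightarrow> (f has_real_derivative f' x) (at x within {a..b})"
    and t: "t \<in> {a..b}"
  shows "left_Caputo_deriv a b \<alpha> f t = left_RL_integral a \<alpha> f' t"
    and "right_Caputo_deriv a b \<alpha> f t = - right_RL_integral b \<alpha> f' t"
proof -
  have f': "vector_derivative f (at x within {a..b}) = f' x" if "x \<in> {a..b}" for x
    using vector_derivative_within_closed_interval[OF \<open>a < b\<close> that] f[OF that]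
    by (simp add: has_real_derivative_iff_has_vector_derivative)
  show "left_Caputo_deriv a b \<alpha> f t = left_RL_integral a \<alpha> f' t"
    unfolding left_Caputo_deriv_def left_RL_integral_def set_lebesgue_integral_def
    using t f' by (intro Bochner_Integration.integral_cong) (auto simp: indicator_def)
  have "right_Caputo_deriv a b \<alpha> f t = (LINT \<tau>:{t<..b}|lebesgue. - (vo_kernel \<alpha> \<tau> t * f' \<tau>))"
    unfolding right_Caputo_deriv_def set_lebesgue_integral_def
    using t f' by (intro Bochner_Integration.integral_cong) (auto simp: indicator_def)
  then show "right_Caputo_deriv a b \<alpha> f t = - right_RL_integral b \<alpha> f' t"
    by (simp add: right_RL_integral_def set_lebesgue_integral_def)
qed

theorem theorem3:
  fixes a b :: real and \<alpha> :: "real \<times> real \<Rightarrow> real" and n :: nat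
  assumes "a < b"
    and "\<alpha> \<in> borel_measurable (lebesgue_on (order_domain a b))"
    and "n \<ge> 2"
    and "\<And>t \<tau>. (t, \<tau>) \<in> order_domain a b \<Longrightarrow> 0 < \<alpha> (t, \<tau>) \<and> \<alpha> (t, \<tau>) < 1 - 1 / real n"
  shows
    "(\<forall>f g :: real \<Rightarrow> real.
        C1_on_interval a b f \<and> continuous_on {a..b} g \<and>
        absolutely_continuous_on {a..b} (right_RL_integral b \<alpha> g) \<longrightarrow>
        set_integrable lebesgue {a..b} (\<lambda>t. g t * left_Caputo_deriv a b \<alpha> f t) \<and>
        set_integrable lebesgue {a..b} (\<lambda>t. f t * right_RL_deriv a b \<alpha> g t) \<and>
        (LINT t:{a..b}|lebesgue. g t * left_Caputo_deriv a b \<alpha> f t) =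
          (f b * right_RL_integral b \<alpha> g b - f a * right_RL_integral b \<alpha> g a) +
          (LINT t:{a..b}|lebesgue. f t * right_RL_deriv a b \<alpha> g t)) \<and>
     (\<forall>f g :: real \<Rightarrow> real.
        C1_on_interval a b f \<and> continuous_on {a..b} g \<and>
        absolutely_continuous_on {a..b} (left_RL_integral a \<alpha> g) \<longrightarrow>
        set_integrable lebesgue {a..b} (\<lambda>t. g t * right_Caputo_deriv a b \<alpha> f t) \<and>
        set_integrable lebesgue {a..b} (\<lambda>t. f t * left_RL_deriv a b \<alpha> g t) \<and>
        (LINT t:{a..b}|lebesgue. g t * right_Caputo_deriv a b \<alpha> f t) =
          - (f b * left_RL_integral a \<alpha> g b - f a * left_RL_integral a \<alpha> g a) +
          (LINT t:{a..b}|lebesgue. f t * left_RL_deriv a b \<alpha> g t))"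
proof (intro conjI allI impI; (elim conjE)?)
  define \<gamma> where "\<gamma> = 1 - 1 / real n"
  have "\<gamma> < 1" using \<open>n \<ge> 2\<close> by (simp add: \<gamma>_def)
  have \<gamma>: "\<forall>p\<in>order_domain a b. 0 < \<alpha> p \<and> \<alpha> p < \<gamma>"
    using assms(4) by (auto simp: \<gamma>_def)
  note exchange = variable_order_integrals_exchange[OF assms(2) \<gamma> \<open>\<gamma> < 1\<close>]
  fix f g :: "real \<Rightarrow> real"
  assume "C1_on_interval a b f" and g: "continuous_on {a..b} g"
  then obtain f' where f: "\<And>x. x \<in> {a..b} \<Longrightarrow> (f has_real_derivative f' x) (at x within {a..b})"
    and f': "continuous_on {a..b} f'"
    unfolding C1_on_interval_def by blast
  have Caputo: "left_Caputo_deriv a b \<alpha> f t = left_RL_integral a \<alpha> f' t"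
    "right_Caputo_deriv a b \<alpha> f t = - right_RL_integral b \<alpha> f' t" if "t \<in> {a..b}" for t
    using Caputo_deriv_eq_RL_integral[OF \<open>a < b\<close> _ that, of f f' \<alpha>] f by auto
  {
    assume AC: "absolutely_continuous_on {a..b} (right_RL_integral b \<alpha> g)"
    note parts = integration_by_parts_absolutely_continuous[OF \<open>a < b\<close> AC f f']
    show "set_integrable lebesgue {a..b} (\<lambda>t. g t * left_Caputo_deriv a b \<alpha> f t)"
      using exchange(1)[OF g f']
      by (rule set_integrable_cong[THEN iffD1, rotated -1]) (simp_all add: Caputo(1))
    show "set_integrable lebesgue {a..b} (\<lambda>t. f t * right_RL_deriv a b \<alpha> g t)"
      using parts(1) by (simp add: right_RL_deriv_def set_integrable_def)
    have "(LINT t:{a..b}|lebesgue. g t * left_Caputo_deriv a b \<alpha> f t)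
        = (LINT t:{a..b}|lebesgue. g t * left_RL_integral a \<alpha> f' t)"
      using Caputo(1) by (intro set_lebesgue_integral_cong) auto
    also have "\<dots> = (LINT \<tau>:{a..b}|lebesgue. f' \<tau> * right_RL_integral b \<alpha> g \<tau>)"
      by (rule exchange(3)[OF g f'])
    finally show "(LINT t:{a..b}|lebesgue. g t * left_Caputo_deriv a b \<alpha> f t) =
          (f b * right_RL_integral b \<alpha> g b - f a * right_RL_integral b \<alpha> g a) +
          (LINT t:{a..b}|lebesgue. f t * right_RL_deriv a b \<alpha> g t)"
      using parts(2) by (simp add: right_RL_deriv_def set_lebesgue_integral_def)
  }
  {
    assume AC: "absolutely_continuous_on {a..b} (left_RL_integral a \<alpha> g)"
    note parts = integration_by_parts_absolutely_continuous[OF \<open>a < b\<close> AC f f']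
    show "set_integrable lebesgue {a..b} (\<lambda>t. g t * right_Caputo_deriv a b \<alpha> f t)"
    proof (rule set_integrable_cong[THEN iffD1, rotated -1])
      show "set_integrable lebesgue {a..b} (\<lambda>t. - (g t * right_RL_integral b \<alpha> f' t))"
        using exchange(2)[OF f' g] by (simp add: set_integrable_def)
    qed (simp_all add: Caputo(2))
    show "set_integrable lebesgue {a..b} (\<lambda>t. f t * left_RL_deriv a b \<alpha> g t)"
      using parts(1) by (simp add: left_RL_deriv_def)
    have "(LINT t:{a..b}|lebesgue. g t * right_Caputo_deriv a b \<alpha> f t)
        = (LINT t:{a..b}|lebesgue. - (g t * right_RL_integral b \<alpha> f' t))"
      using Caputo(2) by (intro set_lebesgue_integral_cong) auto
    also have "\<dots> = - (LINT t:{a..b}|lebesgue. g t * right_RL_integral b \<alpha> f' t)"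
      by (simp add: set_lebesgue_integral_def)
    also have "\<dots> = - (LINT \<tau>:{a..b}|lebesgue. f' \<tau> * left_RL_integral a \<alpha> g \<tau>)"
      by (simp only: exchange(3)[OF f' g])
    finally show "(LINT t:{a..b}|lebesgue. g t * right_Caputo_deriv a b \<alpha> f t) =
          - (f b * left_RL_integral a \<alpha> g b - f a * left_RL_integral a \<alpha> g a) +
          (LINT t:{a..b}|lebesgue. f t * left_RL_deriv a b \<alpha> g t)"
      using parts(2) by (simp add: left_RL_deriv_def)
  }
qed

end
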